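(* Let $\mathbb F$ be an algebraically closed field and $V$ a vector space over $\mathbb F$ of dimension $d+1$ with $d\ge3$. Let $\Phi=(A;\{E_i\}_{i=0}^d;A^*;\{E^*_i\}_{i=0}^d)$ be a self-dual Leonard system on $V$, with dual eigenvalue sequence $\{\theta^*_i\}_{i=0}^d$, and let $a_i=\mathrm{tr}(E^*_iA)$ for $0\le i\le d$. Then the following are equivalent: (i) the Leonard pair $A,A^*$ has spin; (ii) there exist scalars $f_0,f_1,f_2,f_3\in\mathbb F$ (not all zero) such that $f_0+f_1\theta^*_i+f_2a_i+f_3a_i\theta^*_i=0$ for $0\le i\le d$; (iii) for $0\le i,j\le d$, $$(a_i-a_0)(\theta^*_i-\theta^*_d)(a_j-a_d)(\theta^*_j-\theta^*_0)=(a_i-a_d)(\theta^*_i-\theta^*_0)(a_j-a_0)(\theta^*_j-\theta^*_d).$$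
   Context: A tridiagonal matrix is irreducible if all entries on its subdiagonal and superdiagonal are nonzero. A Leonard pair on $V$ is an ordered pair $A,A^*\in \mathrm{End}(V)$ such that (i) there is a basis of $V$ with respect to which $A$ is irreducible tridiagonal and $A^*$ is diagonal; (ii) there is a basis of $V$ with respect to which $A^*$ is irreducible tridiagonal and $A$ is diagonal. Then $A,A^*$ are multiplicity-free (diagonalizable with one-dimensional eigenspaces). The primitive idempotent of $A$ for an eigenvalue $\theta$ is the projection onto the $\theta$-eigenspace along the sum of the other eigenspaces. An ordering of the eigenvalues of $A$ (and the corresponding ordering $\{E_i\}_{i=0}^d$ of primitive idempotents) is standard if corresponding eigenvectors $v_0,\dots,v_d$, in this order, form a basis as in (ii). Standard orderings for $A^*$ are defined similarly using (i). A Leonard system on $V$ is a sequence $\Phi=(A;\{E_i\}_{i=0}^d;A^*;\{E^*_i\}_{i=0}^d)$ where $A,A^*$ is a Leonard pair on $V$ and $\{E_i\}$, $\{E^*_i\}$ are standard orderings of the primitive idempotents of $A$, $A^*$. The dual eigenvalue sequence $\{\theta^*_i\}$ is given by $A^*E^*_i=\theta^*_iE^*_i$. $\Phi$ is self-dual whenever $\Phi$ is isomorphic to $\Phi^*=(A^*;\{E^*_i\}_{i=0}^d;A;\{E_i\}_{i=0}^d)$, i.e. there is an $\mathbb F$-algebra isomorphism $\sigma:\mathrm{End}(V)\to\mathrm{End}(V)$ with $A^\sigma=A^*$, $(A^* )^\sigma=A$, $E_i^\sigma=E^*_i$, $(E^*_i)^\sigma=E_i$ for $0\le i\le d$. $A,A^*$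 has spin whenever there exist invertible $W,W^*\in\mathrm{End}(V)$ such that $WA=AW$, $W^*A^*=A^*W^*$, and $WA^*W^{-1}=(W^* )^{-1}AW^*$. *)

theory Defs
  imports Complex_Main "HOL-Computational_Algebra.Polynomial"
begin

text \<open>
  The vector space \<open>V\<close> is the whole type \<open>'b\<close>, with scalar multiplication \<open>scale\<close> (written \<open>*s\<close>)
  as in the library locale \<open>vector_space\<close>. Sequences indexed by \<open>0, \<dots>, d\<close> are functions on \<open>nat\<close>
  of which only the values at arguments \<open>\<le> d\<close> are ever used.
\<close>

text \<open>
  No assumptions are added to \<open>vector_space\<close>; a separate locale merely keeps the definitions below
  out of the library's interpretations of \<open>vector_space\<close>.
\<close>

locale endo_space = vector_space scale
  for scale :: "'a::field \<Rightarrow> 'b::ab_group_add \<Rightarrow> 'b" (infixr \<open>*s\<close> 75)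
begin

abbreviation End_space :: "('b \<Rightarrow> 'b) set" where
  "End_space \<equiv> {f. Vector_Spaces.linear scale scale f}"

definition ordered_basis :: "nat \<Rightarrow> (nat \<Rightarrow> 'b) \<Rightarrow> bool" where
  "ordered_basis d v \<longleftrightarrow>
     inj_on v {..d} \<and> independent (v ` {..d}) \<and> span (v ` {..d}) = UNIV"

text \<open>Column convention: \<open>f (v j) = (\<Sum>i\<le>d. matrix_entry d v f i j *s v i)\<close>.\<close>

definition matrix_entry :: "nat \<Rightarrow> (nat \<Rightarrow> 'b) \<Rightarrow> ('b \<Rightarrow> 'b) \<Rightarrow> nat \<Rightarrow> nat \<Rightarrow> 'a" where
  "matrix_entry d v f i j = representation (v ` {..d}) (f (v j)) (v i)"

definition trace_map :: "('b \<Rightarrow> 'b) \<Rightarrow> 'a" where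
  "trace_map f =
     (let B = (SOME B. independent B \<and> span B = UNIV) in \<Sum>b\<in>B. representation B (f b) b)"

text \<open>The choice of basis in the definition of the trace is immaterial.\<close>

lemma trace_basis_independent:
  assumes f: "Vector_Spaces.linear scale scale f"
    and B: "independent B" "span B = UNIV" "finite B"
    and C: "independent C" "span C = UNIV" "finite C"
  shows "(\<Sum>b\<in>B. representation B (f b) b) = (\<Sum>c\<in>C. representation C (f c) c)"
proof -
  interpret f: Vector_Spaces.linear scale scale f by (fact f)
  have expB: "(\<Sum>b\<in>B. representation B x b *s b) = x" for x
    by (rule sum_representation_eq) (use B in auto)
  have expC: "(\<Sum>c\<in>C. representation C x c *s c) = x" for x
    by (rule sum_representation_eq) (use C in auto)
  have 1: "representation B (f b) b = (\<Sum>c\<in>C. representation C b c * representation B (f c) b)" for b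
  proof -
    have "f b = f (\<Sum>c\<in>C. representation C b c *s c)" by (simp add: expC)
    also have "\<dots> = (\<Sum>c\<in>C. representation C b c *s f c)"
      by (simp add: f.sum f.scale)
    finally have "representation B (f b) = representation B (\<Sum>c\<in>C. representation C b c *s f c)"
      by simp
    also have "\<dots> = (\<lambda>b'. \<Sum>c\<in>C. representation C b c * representation B (f c) b')"
      using B by (simp add: representation_sum representation_scale)
    finally show ?thesis by simp
  qed
  have 2: "representation C (f c) c = (\<Sum>b\<in>B. representation B (f c) b * representation C b c)" for c
  proof -
    have "representation C (f c) = representation C (\<Sum>b\<in>B. representation B (f c) b *s b)"
      by (simp add: expB)
    also have "\<dots> = (\<lambda>c'. \<Sum>b\<in>B. representation B (f c) b * representation C b c')"
      using C by (simp add: representation_sum representation_scale)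
    finally show ?thesis by simp
  qed
  show ?thesis
    unfolding 1 2 by (subst sum.swap) (simp add: mult.commute)
qed

definition eigenspace :: "('b \<Rightarrow> 'b) \<Rightarrow> 'a \<Rightarrow> 'b set" where
  "eigenspace f \<theta> = {x. f x = \<theta> *s x}"

definition eigenvalue :: "('b \<Rightarrow> 'b) \<Rightarrow> 'a \<Rightarrow> bool" where
  "eigenvalue f \<theta> \<longleftrightarrow> eigenspace f \<theta> \<noteq> {0}"

text \<open>
  \<open>P\<close> is the projection onto the \<open>\<theta>\<close>-eigenspace of \<open>f\<close> along the sum of the other eigenspaces.
  This determines \<open>P\<close> uniquely when \<open>f\<close> is diagonalizable, the only case in which it is used.
\<close>

definition primitive_idempotent :: "('b \<Rightarrow> 'b) \<Rightarrow> 'a \<Rightarrow> ('b \<Rightarrow> 'b) \<Rightarrow> bool" where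
  "primitive_idempotent f \<theta> P \<longleftrightarrow>
     eigenvalue f \<theta> \<and> P \<in> End_space \<and>
     (\<forall>x\<in>eigenspace f \<theta>. P x = x) \<and>
     (\<forall>x\<in>span (\<Union>\<mu>\<in>{\<mu>. eigenvalue f \<mu> \<and> \<mu> \<noteq> \<theta>}. eigenspace f \<mu>). P x = 0)"

definition irreducible_tridiagonal :: "nat \<Rightarrow> (nat \<Rightarrow> nat \<Rightarrow> 'a) \<Rightarrow> bool" where
  "irreducible_tridiagonal d M \<longleftrightarrow>
     (\<forall>i\<le>d. \<forall>j\<le>d. i + 1 < j \<or> j + 1 < i \<longrightarrow> M i j = 0) \<and>
     (\<forall>i<d. M i (i + 1) \<noteq> 0 \<and> M (i + 1) i \<noteq> 0)"

definition diagonal_matrix :: "nat \<Rightarrow> (nat \<Rightarrow> nat \<Rightarrow> 'a) \<Rightarrow> bool" where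
  "diagonal_matrix d M \<longleftrightarrow> (\<forall>i\<le>d. \<forall>j\<le>d. i \<noteq> j \<longrightarrow> M i j = 0)"

definition leonard_basis :: "nat \<Rightarrow> ('b \<Rightarrow> 'b) \<Rightarrow> ('b \<Rightarrow> 'b) \<Rightarrow> (nat \<Rightarrow> 'b) \<Rightarrow> bool" where
  "leonard_basis d T D v \<longleftrightarrow>
     ordered_basis d v \<and>
     irreducible_tridiagonal d (matrix_entry d v T) \<and>
     diagonal_matrix d (matrix_entry d v D)"

definition leonard_pair :: "nat \<Rightarrow> ('b \<Rightarrow> 'b) \<Rightarrow> ('b \<Rightarrow> 'b) \<Rightarrow> bool" where
  "leonard_pair d A As \<longleftrightarrow>
     A \<in> End_space \<and> As \<in> End_space \<and>
     (\<exists>v. leonard_basis d A As v) \<and> (\<exists>v. leonard_basis d As A v)"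

text \<open>
  \<open>E\<close> is a standard ordering of the primitive idempotents of \<open>D\<close>, for a Leonard pair consisting of
  \<open>D\<close> and \<open>T\<close> in either order.
\<close>

definition standard_ordering ::
    "nat \<Rightarrow> ('b \<Rightarrow> 'b) \<Rightarrow> ('b \<Rightarrow> 'b) \<Rightarrow> (nat \<Rightarrow> 'b \<Rightarrow> 'b) \<Rightarrow> bool" where
  "standard_ordering d D T E \<longleftrightarrow>
     (\<exists>\<theta> v. bij_betw \<theta> {..d} {\<mu>. eigenvalue D \<mu>} \<and>
        (\<forall>i\<le>d. primitive_idempotent D (\<theta> i) (E i)) \<and>
        (\<forall>i\<le>d. v i \<in> eigenspace D (\<theta> i)) \<and>
        leonard_basis d T D v)"

definition leonard_system ::
    "nat \<Rightarrow> ('b \<Rightarrow> 'b) \<Rightarrow> (nat \<Rightarrow> 'b \<Rightarrow> 'b) \<Rightarrow> ('b \<Rightarrow> 'b) \<Rightarrow> (nat \<Rightarrow> 'b \<Rightarrow> 'b) \<Rightarrow> bool" where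
  "leonard_system d A E As Es \<longleftrightarrow>
     leonard_pair d A As \<and> standard_ordering d A As E \<and> standard_ordering d As A Es"

definition dual_eigenvalue_sequence ::
    "nat \<Rightarrow> ('b \<Rightarrow> 'b) \<Rightarrow> (nat \<Rightarrow> 'b \<Rightarrow> 'b) \<Rightarrow> (nat \<Rightarrow> 'a) \<Rightarrow> bool" where
  "dual_eigenvalue_sequence d As Es \<theta>s \<longleftrightarrow> (\<forall>i\<le>d. As \<circ> Es i = (\<lambda>x. \<theta>s i *s Es i x))"

definition End_algebra_iso :: "(('b \<Rightarrow> 'b) \<Rightarrow> ('b \<Rightarrow> 'b)) \<Rightarrow> bool" where
  "End_algebra_iso \<sigma> \<longleftrightarrow>
     bij_betw \<sigma> End_space End_space \<and>
     \<sigma> id = id \<and>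
     (\<forall>f\<in>End_space. \<forall>g\<in>End_space. \<sigma> (\<lambda>x. f x + g x) = (\<lambda>x. \<sigma> f x + \<sigma> g x)) \<and>
     (\<forall>f\<in>End_space. \<forall>c. \<sigma> (\<lambda>x. c *s f x) = (\<lambda>x. c *s \<sigma> f x)) \<and>
     (\<forall>f\<in>End_space. \<forall>g\<in>End_space. \<sigma> (f \<circ> g) = \<sigma> f \<circ> \<sigma> g)"

definition leonard_system_isomorphic ::
    "nat \<Rightarrow> ('b \<Rightarrow> 'b) \<Rightarrow> (nat \<Rightarrow> 'b \<Rightarrow> 'b) \<Rightarrow> ('b \<Rightarrow> 'b) \<Rightarrow> (nat \<Rightarrow> 'b \<Rightarrow> 'b) \<Rightarrow>
     ('b \<Rightarrow> 'b) \<Rightarrow> (nat \<Rightarrow> 'b \<Rightarrow> 'b) \<Rightarrow> ('b \<Rightarrow> 'b) \<Rightarrow> (nat \<Rightarrow> 'b \<Rightarrow> 'b) \<Rightarrow> bool" where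
  "leonard_system_isomorphic d A E As Es A' E' As' Es' \<longleftrightarrow>
     (\<exists>\<sigma>. End_algebra_iso \<sigma> \<and> \<sigma> A = A' \<and> \<sigma> As = As' \<and>
        (\<forall>i\<le>d. \<sigma> (E i) = E' i \<and> \<sigma> (Es i) = Es' i))"

definition self_dual ::
    "nat \<Rightarrow> ('b \<Rightarrow> 'b) \<Rightarrow> (nat \<Rightarrow> 'b \<Rightarrow> 'b) \<Rightarrow> ('b \<Rightarrow> 'b) \<Rightarrow> (nat \<Rightarrow> 'b \<Rightarrow> 'b) \<Rightarrow> bool" where
  "self_dual d A E As Es \<longleftrightarrow> leonard_system_isomorphic d A E As Es As Es A E"

definition has_spin :: "('b \<Rightarrow> 'b) \<Rightarrow> ('b \<Rightarrow> 'b) \<Rightarrow> bool" where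
  "has_spin A As \<longleftrightarrow>
     (\<exists>W\<in>End_space. \<exists>Ws\<in>End_space. bij W \<and> bij Ws \<and>
        W \<circ> A = A \<circ> W \<and> Ws \<circ> As = As \<circ> Ws \<and>
        W \<circ> As \<circ> inv W = inv Ws \<circ> A \<circ> Ws)"

end

end

theory Submission
  imports Defs
begin

text \<open>
  Let \<open>v\<close> be an eigenbasis of \<open>A\<^sup>*\<close> and \<open>u\<close> one of \<open>A\<close>, each making the other map irreducible
  tridiagonal. By self-duality both maps have eigenvalues \<open>\<theta>\<^sub>i\<close> and both diagonals are \<open>a\<^sub>i\<close>.

  A map that is tridiagonal in both bases is a combination \<open>B\<close> of
  \<open>1, A, A\<^sup>*, A A\<^sup>*, A\<^sup>* A\<close>. For a spin pair this applies to \<open>B = W A\<^sup>* W\<^sup>-\<^sup>1 = (W\<^sup>*)\<^sup>-\<^sup>1 A W\<^sup>*\<close>,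
  and comparing diagonals gives a relation as in (ii).

  Conversely, \<open>\<theta>\<^sub>i, \<theta>\<^sub>i\<^sub>+\<^sub>1\<close> lie on a symmetric quadric and \<open>a\<^sub>i\<close> is a quotient of two quadratic
  polynomials in \<open>\<theta>\<^sub>i\<close>. Under (ii) these polynomials share a factor, which makes it possible to choose
  the coefficients of \<open>B\<close> such that diagonal \<open>W, W\<^sup>*\<close> with \<open>W A\<^sup>* = B W\<close> and \<open>A W\<^sup>* = W\<^sup>* B\<close> exist.

  Condition (iii) is the vanishing of the determinant with rows \<open>(1, \<theta>\<^sub>k, a\<^sub>k, a\<^sub>k \<theta>\<^sub>k)\<close> for
  \<open>k = 0, d, i, j\<close>.
\<close>

subsection \<open>The bilinear relation and its parameters\<close>

text \<open>The coefficients form a nonzero vector annihilated by the four rows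
  \<open>(1, x, y, y * x)\<close>, so the determinant of these rows vanishes. Up to sign it is the
  difference of the two sides.\<close>

lemma bilinear_relation_imp_cross_ratio:
  fixes f0 f1 f2 f3 :: "'a::field"
  assumes nz: "\<not> (f0 = 0 \<and> f1 = 0 \<and> f2 = 0 \<and> f3 = 0)"
    and "f0 + f1 * x0 + f2 * y0 + f3 * y0 * x0 = 0" "f0 + f1 * x1 + f2 * y1 + f3 * y1 * x1 = 0"
      "f0 + f1 * x2 + f2 * y2 + f3 * y2 * x2 = 0" "f0 + f1 * x3 + f2 * y3 + f3 * y3 * x3 = 0"
  shows "(y2 - y0) * (x2 - x1) * (y3 - y1) * (x3 - x0) = (y2 - y1) * (x2 - x0) * (y3 - y0) * (x3 - x1)"
proof (rule ccontr)
  assume "\<not> ?thesis"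
  then have D: "(y2 - y0) * (x2 - x1) * (y3 - y1) * (x3 - x0) - (y2 - y1) * (x2 - x0) * (y3 - y0) * (x3 - x1) \<noteq> 0"
    (is "?D \<noteq> 0") by simp
  \<comment> \<open>This is Cramer's rule for the last unknown.\<close>
  have "?D * f3 = 0" using assms(2-5) by algebra
  then have f3: "f3 = 0" using D by simp
  have f2: "f2 = 0"
  proof (rule ccontr)
    assume "f2 \<noteq> 0"
    define m where "m = - f1 / f2"
    define n where "n = - f0 / f2"
    \<comment> \<open>Once \<open>y\<close> is affine in \<open>x\<close>, both products equal
      \<open>m\<close> squared times the same four differences of \<open>x\<close>.\<close>
    have "y0 = m * x0 + n" "y1 = m * x1 + n" "y2 = m * x2 + n" "y3 = m * x3 + n"
      using assms(2-5) f3 \<open>f2 \<noteq> 0\<close> by (simp_all add: m_def n_def divide_simps) algebra+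
    then have "?D = 0" by algebra
    then show False using D by simp
  qed
  have "f1 = 0"
  proof (rule ccontr)
    assume "f1 \<noteq> 0"
    then have "f1 * x1 = f1 * x2" using assms(3,4) f2 f3 by (simp add: add_eq_0_iff)
    moreover have "f1 * x0 = f1 * x2" using assms(2,4) f2 f3 by (simp add: add_eq_0_iff)
    ultimately show False using D \<open>f1 \<noteq> 0\<close> by simp
  qed
  with f2 f3 assms(2) nz show False by simp
qed

text \<open>For the converse, \<open>j\<close> is frozen: the identity in \<open>i\<close> alone is
  then a bilinear relation, and it can be trivial for every \<open>j\<close> only if
  \<open>y\<close> is constant.\<close>

lemma bilinear_relation_iff_cross_ratio:
  fixes x y :: "nat \<Rightarrow> 'a::field"
  assumes "d \<ge> 2" and inj: "inj_on x {..d}"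
  shows "(\<exists>f0 f1 f2 f3. \<not> (f0 = 0 \<and> f1 = 0 \<and> f2 = 0 \<and> f3 = 0) \<and>
            (\<forall>i\<le>d. f0 + f1 * x i + f2 * y i + f3 * y i * x i = 0)) \<longleftrightarrow>
         (\<forall>i\<le>d. \<forall>j\<le>d. (y i - y 0) * (x i - x d) * (y j - y d) * (x j - x 0) =
            (y i - y d) * (x i - x 0) * (y j - y 0) * (x j - x d))"
    (is "?L \<longleftrightarrow> ?R")
proof
  assume ?L
  then obtain f0 f1 f2 f3 where nz: "\<not> (f0 = 0 \<and> f1 = 0 \<and> f2 = 0 \<and> f3 = 0)"
    and rel: "\<And>i. i \<le> d \<Longrightarrow> f0 + f1 * x i + f2 * y i + f3 * y i * x i = 0" by blast
  show ?R
  proof (intro allI impI)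
    fix i j assume "i \<le> d" "j \<le> d"
    then show "(y i - y 0) * (x i - x d) * (y j - y d) * (x j - x 0) =
        (y i - y d) * (x i - x 0) * (y j - y 0) * (x j - x d)"
      by (intro bilinear_relation_imp_cross_ratio[OF nz] rel) auto
  qed
next
  assume R: ?R
  have ne: "x i \<noteq> x j" if "i \<noteq> j" "i \<le> d" "j \<le> d" for i j
    using inj_onD[OF inj, of i j] that by auto
  show ?L
  proof (cases "\<exists>j\<le>d. (y j - y d) * (x j - x 0) \<noteq> 0 \<or> (y j - y 0) * (x j - x d) \<noteq> 0")
    case True
    then obtain j where j: "j \<le> d" "(y j - y d) * (x j - x 0) \<noteq> 0 \<or> (y j - y 0) * (x j - x d) \<noteq> 0" by blast
    define p where "p = (y j - y d) * (x j - x 0)"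
    define q where "q = (y j - y 0) * (x j - x d)"
    have rel: "p * ((y i - y 0) * (x i - x d)) = q * ((y i - y d) * (x i - x 0))" if "i \<le> d" for i
      using R[rule_format, OF that j(1)] unfolding p_def q_def by (simp only: ac_simps)
    \<comment> \<open>The four coefficients come from expanding \<open>rel\<close>. Equality
      \<open>p = q\<close> together with \<open>q * x 0 = p * x d\<close> would force
      \<open>p = q = 0\<close>, because \<open>x 0\<close> and \<open>x d\<close> differ.\<close>
    have "\<not> (p * (y 0 * x d) - q * (y d * x 0) = 0 \<and> q * y d - p * y 0 = 0 \<and> q * x 0 - p * x d = 0 \<and> p - q = 0)"
    proof
      assume "p * (y 0 * x d) - q * (y d * x 0) = 0 \<and> q * y d - p * y 0 = 0 \<and> q * x 0 - p * x d = 0 \<and> p - q = 0"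
      then have "p = q" "q * x 0 = p * x d" by auto
      then have "p = 0" "q = 0" using ne[of 0 d] \<open>d \<ge> 2\<close> by auto
      then show False using j(2) by (simp add: p_def q_def)
    qed
    moreover have "\<forall>i\<le>d. (p * (y 0 * x d) - q * (y d * x 0)) + (q * y d - p * y 0) * x i +
        (q * x 0 - p * x d) * y i + (p - q) * y i * x i = 0"
    proof (intro allI impI)
      fix i assume "i \<le> d"
      then show "(p * (y 0 * x d) - q * (y d * x 0)) + (q * y d - p * y 0) * x i +
          (q * x 0 - p * x d) * y i + (p - q) * y i * x i = 0"
        using rel[OF \<open>i \<le> d\<close>] by algebra
    qed
    ultimately show ?thesis by (intro exI conjI)
  next
    case False
    have *: "y i = y d" if "i \<le> d" "i \<noteq> 0" for i
    proof -
      have "(y i - y d) * (x i - x 0) = 0" using False that(1) by blast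
      then show ?thesis using ne[of i 0] that by simp
    qed
    have **: "y i = y 0" if "i \<le> d" "i \<noteq> d" for i
    proof -
      have "(y i - y 0) * (x i - x d) = 0" using False that(1) by blast
      then show ?thesis using ne[of i d] that by simp
    qed
    \<comment> \<open>The index 1 differs from both 0 and \<open>d\<close>, so it links the two
      constant values.\<close>
    have "y d = y 0" using *[of 1] **[of 1] \<open>d \<ge> 2\<close> by simp
    then have const: "y i = y 0" if "i \<le> d" for i
      using **[OF that] by (cases "i = d") simp_all
    have rel: "- y 0 + 0 * x i + 1 * y i + 0 * y i * x i = 0" if "i \<le> d" for i
      unfolding const[OF that] by simp
    have "\<not> (- y 0 = 0 \<and> (0::'a) = 0 \<and> (1::'a) = 0 \<and> (0::'a) = 0) \<and>
        (\<forall>i\<le>d. - y 0 + 0 * x i + 1 * y i + 0 * y i * x i = 0)"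
      by (rule conjI, simp, intro allI impI, rule rel)
    then show ?thesis
      by - (rule exI[of _ "- y 0"], rule exI[of _ 0], rule exI[of _ 1], rule exI[of _ 0])
  qed
qed

section \<open>Solving for the spin parameters\<close>

text \<open>A nonzero polynomial of degree at most 3 cannot have the \<open>d + 1\<close>, hence at
  least four, distinct roots \<open>x i\<close>.\<close>

lemma cubic_eq_zero:
  fixes x :: "nat \<Rightarrow> 'a::field"
  assumes "d \<ge> 3" and "inj_on x {..d}"
    and "\<And>i. i \<le> d \<Longrightarrow> c0 + c1 * x i + c2 * (x i)\<^sup>2 + c3 * (x i)^3 = 0"
  shows "c0 = 0 \<and> c1 = 0 \<and> c2 = 0 \<and> c3 = 0"
proof -
  have "[:c0, c1, c2, c3:] = 0"
  proof (rule poly_eqI_degree)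
    show "poly [:c0, c1, c2, c3:] z = poly 0 z" if "z \<in> x ` {..d}" for z
      using that assms(3) by (auto simp: algebra_simps power2_eq_square power3_eq_cube)
    have "card (x ` {..d}) = d + 1" using assms(2) by (simp add: card_image)
    then show "degree [:c0, c1, c2, c3:] < card (x ` {..d})" "degree (0 :: 'a poly) < card (x ` {..d})"
      using assms(1) by (auto simp: degree_pCons_le)
  qed
  then show ?thesis by simp
qed

lemma sum_prod_exist:
  fixes s p :: "'a::alg_closed_field"
  shows "\<exists>y z. y + z = s \<and> y * z = p"
proof -
  obtain y where "poly [:p, -s, 1:] y = 0"
    using alg_closed_imp_poly_has_root[of "[:p, -s, 1:]"] by auto
  then have "y + (s - y) = s" "y * (s - y) = p" by (auto simp: algebra_simps)
  then show ?thesis by blast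
qed

text \<open>These are the conditions for \<open>B = combination e0 e1 e1 e2 e3\<close> to be a
  diagonal conjugate of \<open>As\<close> in \<open>u\<close> and of \<open>A\<close> in
  \<open>v\<close>. The factors at opposite off-diagonal positions must be reciprocal, and the
  diagonal entries must equal \<open>a i\<close>. Giving \<open>A\<close> and \<open>As\<close> the
  same coefficient makes the conditions in the two bases coincide.\<close>

definition spin_parameters :: "nat \<Rightarrow> (nat \<Rightarrow> 'a::field) \<Rightarrow> (nat \<Rightarrow> 'a) \<Rightarrow> bool" where
  "spin_parameters d \<theta> a \<longleftrightarrow> (\<exists>e0 e1 e2 e3.
     (\<forall>i<d. (e1 + e2 * \<theta> (i + 1) + e3 * \<theta> i) * (e1 + e2 * \<theta> i + e3 * \<theta> (i + 1)) = 1) \<and>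
     (\<forall>i\<le>d. e0 + (e1 - 1) * a i + e1 * \<theta> i + (e2 + e3) * a i * \<theta> i = 0))"

text \<open>Subtracting \<open>m\<close> from both maps and from \<open>B\<close> leaves the form of
  the combination intact: \<open>e2\<close> and \<open>e3\<close> stay the same, and only
  \<open>e0\<close> and \<open>e1\<close> are adjusted.\<close>

lemma spin_parameters_translate:
  fixes \<theta> a :: "nat \<Rightarrow> 'a::field"
  assumes "spin_parameters d (\<lambda>i. \<theta> i - m) (\<lambda>i. a i - m)"
  shows "spin_parameters d \<theta> a"
proof -
  obtain e0 e1 e2 e3 where
    e: "\<And>i. i < d \<Longrightarrow> (e1 + e2 * (\<theta> (i + 1) - m) + e3 * (\<theta> i - m)) * (e1 + e2 * (\<theta> i - m) + e3 * (\<theta> (i + 1) - m)) = 1"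
      "\<And>i. i \<le> d \<Longrightarrow> e0 + (e1 - 1) * (a i - m) + e1 * (\<theta> i - m) + (e2 + e3) * (a i - m) * (\<theta> i - m) = 0"
    using assms unfolding spin_parameters_def by blast
  define g0 where "g0 = e0 - (e1 - 1) * m - e1 * m + (e2 + e3) * m * m"
  define g1 where "g1 = e1 - (e2 + e3) * m"
  have "(g1 + e2 * \<theta> (i + 1) + e3 * \<theta> i) * (g1 + e2 * \<theta> i + e3 * \<theta> (i + 1)) = 1" if "i < d" for i
    using e(1)[OF that] by (simp add: g1_def algebra_simps)
  moreover have "g0 + (g1 - 1) * a i + g1 * \<theta> i + (e2 + e3) * a i * \<theta> i = 0" if "i \<le> d" for i
    using e(2)[OF that] by (simp add: g0_def g1_def algebra_simps)
  ultimately show ?thesis unfolding spin_parameters_def by blast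
qed

text \<open>
  The two factors in \<open>spin_parameters\<close> multiply to \<open>1\<close> on consecutive eigenvalues as soon as, with
  \<open>s = e2 + e3\<close> and \<open>p = e2 * e3\<close>, their product minus \<open>1\<close> is \<open>p\<close> times the quadric
  satisfied by consecutive eigenvalues.
\<close>

lemma spin_parametersI:
  fixes \<theta> a :: "nat \<Rightarrow> 'a::alg_closed_field"
  assumes P: "\<And>i. i < d \<Longrightarrow> (\<theta> i)\<^sup>2 - \<beta> * \<theta> i * \<theta> (i + 1) + (\<theta> (i + 1))\<^sup>2 - \<gamma> * (\<theta> i + \<theta> (i + 1)) - \<rho> = 0"
    and s: "s\<^sup>2 = (2 - \<beta>) * p" "e1 * s = - \<gamma> * p" "e1\<^sup>2 - 1 = - \<rho> * p"
    and M: "\<And>i. i \<le> d \<Longrightarrow> e0 + (e1 - 1) * a i + e1 * \<theta> i + s * a i * \<theta> i = 0"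
  shows "spin_parameters d \<theta> a"
proof -
  \<comment> \<open>Only the sum and the product of \<open>e2\<close> and \<open>e3\<close> are
    prescribed; they are the roots of a quadratic polynomial over an algebraically closed
    field.\<close>
  obtain e2 e3 where e: "e2 + e3 = s" "e2 * e3 = p" using sum_prod_exist by blast
  have "(e1 + e2 * y + e3 * x) * (e1 + e2 * x + e3 * y) = 1"
    if "x\<^sup>2 - \<beta> * x * y + y\<^sup>2 - \<gamma> * (x + y) - \<rho> = 0" for x y
  proof -
    have "(e1 + e2 * y + e3 * x) * (e1 + e2 * x + e3 * y) - 1 =
        (e1\<^sup>2 - 1) + e1 * (e2 + e3) * (x + y) + e2 * e3 * (x\<^sup>2 + y\<^sup>2) +
        ((e2 + e3)\<^sup>2 - 2 * (e2 * e3)) * x * y"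
      by algebra
    also have "\<dots> = p * (x\<^sup>2 - \<beta> * x * y + y\<^sup>2 - \<gamma> * (x + y) - \<rho>)"
      unfolding e s by algebra
    finally show ?thesis using that by simp
  qed
  then show ?thesis using P M e(1) unfolding spin_parameters_def by blast
qed

text \<open>Multiplying the bilinear relation by the quadratic denominator of \<open>a\<close>
  eliminates \<open>a\<close> and leaves a cubic in \<open>x\<close>. No division occurs, so zeros
  of the denominator are harmless.\<close>

lemma cubic_relation:
  fixes x a :: "'a::field"
  assumes N: "a * ((2 - \<beta>) * x\<^sup>2 - 2 * \<gamma> * x - \<rho>) = \<gamma> * x\<^sup>2 + \<omega> * x + \<eta>"
    and L: "f0 + f1 * x + f2 * a + f3 * a * x = 0"
  shows "(f2 * \<eta> - f0 * \<rho>) + (f2 * \<omega> + f3 * \<eta> - f1 * \<rho> - 2 * \<gamma> * f0) * x +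
      ((2 - \<beta>) * f0 - 2 * \<gamma> * f1 + f2 * \<gamma> + f3 * \<omega>) * x\<^sup>2 +
      ((2 - \<beta>) * f1 + f3 * \<gamma>) * x ^ 3 = 0" (is "?l = 0")
proof -
  define D where "D = (2 - \<beta>) * x\<^sup>2 - 2 * \<gamma> * x - \<rho>"
  have "?l = (\<gamma> * x\<^sup>2 + \<omega> * x + \<eta>) * (f2 + f3 * x) + (f0 + f1 * x) * D"
    unfolding D_def by algebra
  also have "\<dots> = D * (f0 + f1 * x + f2 * a + f3 * a * x)"
    unfolding N[symmetric] D_def[symmetric] by algebra
  finally show ?thesis using L by simp
qed

text \<open>With \<open>\<gamma> = 0\<close> one may take \<open>e1 = 0\<close> and
  \<open>p = 1 / \<rho>\<close>. What remains is to bring the bilinear relation to the form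
  \<open>e0 - a i + s * a i * \<theta> i = 0\<close> with \<open>s\<close> squared equal to
  \<open>(2 - \<beta>) / \<rho>\<close>; the vanishing coefficients of the cubic provide
  this.\<close>

lemma spin_parameters_centered:
  fixes \<theta> a :: "nat \<Rightarrow> 'a::alg_closed_field"
  assumes d: "d \<ge> 3" and inj: "inj_on \<theta> {..d}" and b: "\<beta> \<noteq> 2"
    and P: "\<And>i. i < d \<Longrightarrow> (\<theta> i)\<^sup>2 - \<beta> * \<theta> i * \<theta> (i + 1) + (\<theta> (i + 1))\<^sup>2 - \<rho> = 0"
    and N: "\<And>i. i \<le> d \<Longrightarrow> a i * ((2 - \<beta>) * (\<theta> i)\<^sup>2 - \<rho>) = \<omega> * \<theta> i + \<eta>"
    and interior: "\<And>i. 0 < i \<Longrightarrow> i < d \<Longrightarrow> (2 - \<beta>) * (\<theta> i)\<^sup>2 - \<rho> \<noteq> 0"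
    and Q: "(2 - \<beta>) * \<theta> 0 * a 0 + \<rho> - \<omega> \<noteq> 0"
    and nz: "\<not> (f0 = 0 \<and> f1 = 0 \<and> f2 = 0 \<and> f3 = 0)"
    and L: "\<And>i. i \<le> d \<Longrightarrow> f0 + f1 * \<theta> i + f2 * a i + f3 * a i * \<theta> i = 0"
  shows "spin_parameters d \<theta> a"
proof -
  have ne: "\<theta> i \<noteq> \<theta> j" if "i \<noteq> j" "i \<le> d" "j \<le> d" for i j
    using inj_onD[OF inj, of i j] that by auto
  have "(f2 * \<eta> - f0 * \<rho>) + (f2 * \<omega> + f3 * \<eta> - f1 * \<rho>) * \<theta> i +
      ((2 - \<beta>) * f0 + f3 * \<omega>) * (\<theta> i)\<^sup>2 + ((2 - \<beta>) * f1) * (\<theta> i) ^ 3 = 0" if "i \<le> d" for i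
    using cubic_relation[of "a i" \<beta> "\<theta> i" 0 \<rho> \<omega> \<eta> f0 f1 f2 f3] N[OF that] L[OF that] by simp
  note coeffs = cubic_eq_zero[OF d inj this]
  have f1: "f1 = 0" using coeffs b by simp
  have c0: "f2 * \<eta> = f0 * \<rho>" and c1: "f2 * \<omega> = - (f3 * \<eta>)" and c2: "(2 - \<beta>) * f0 = - (f3 * \<omega>)"
    using coeffs f1 by (simp_all add: eq_neg_iff_add_eq_0)
  have zero: "\<omega> = 0 \<and> \<eta> = 0" if "f0 = 0"
    using c0 c1 c2 nz f1 that by (cases "f3 = 0") auto
  \<comment> \<open>If \<open>\<rho>\<close> vanished, the coefficient equations, with
    \<open>N\<close> or \<open>L\<close> at index 0, would make the expression in \<open>Q\<close>
    zero.\<close>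
  have "\<rho> \<noteq> 0"
  proof
    assume \<rho>: "\<rho> = 0"
    show False
    proof (cases "f0 = 0")
      case True
      then have "a 0 * \<theta> 0 = 0" using zero N[of 0] b \<rho> by auto
      then show False using Q zero[OF True] \<rho> by auto
    next
      case False
      then have "f3 \<noteq> 0" "\<omega> \<noteq> 0" using c2 b by auto
      then have "f2 = 0" using c0 c1 \<rho> by auto
      have "f3 * ((2 - \<beta>) * \<theta> 0 * a 0 + \<rho> - \<omega>) = 0"
        using L[of 0] c2 f1 \<open>f2 = 0\<close> \<rho> by simp algebra
      then show False using Q \<open>f3 \<noteq> 0\<close> by simp
    qed
  qed
  have "\<exists>s e0. s\<^sup>2 = (2 - \<beta>) / \<rho> \<and> (\<forall>i\<le>d. e0 - a i + s * a i * \<theta> i = 0)"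
  proof (cases "f0 = 0")
    case True
    have zero_or: "a i = 0 \<or> (2 - \<beta>) * (\<theta> i)\<^sup>2 = \<rho>" if "i \<le> d" for i
      using N[OF that] zero[OF True] by auto
    have zero_or': "a i = 0 \<or> f2 + f3 * \<theta> i = 0" if "i \<le> d" for i
      using L[OF that] f1 True by simp algebra
    \<comment> \<open>Two indices with nonzero \<open>a\<close> would give the affine function
      \<open>f2 + f3 * \<theta>\<close> two roots, making the whole relation trivial.\<close>
    have uniq: "i = j" if "i \<le> d" "j \<le> d" "a i \<noteq> 0" "a j \<noteq> 0" for i j
    proof (rule ccontr)
      assume "i \<noteq> j"
      have *: "f2 + f3 * \<theta> i = 0" "f2 + f3 * \<theta> j = 0" using zero_or' that by auto
      then have "f3 * (\<theta> i - \<theta> j) = 0" by algebra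
      then have "f3 = 0" using ne[OF \<open>i \<noteq> j\<close> that(1,2)] by simp
      then show False using * nz True f1 by simp
    qed
    show ?thesis
    proof (cases "\<exists>k\<le>d. a k \<noteq> 0")
      case True
      then obtain k where k: "k \<le> d" "a k \<noteq> 0" by blast
      then have \<theta>k: "(2 - \<beta>) * (\<theta> k)\<^sup>2 = \<rho>" using zero_or by blast
      then have "\<theta> k \<noteq> 0" using \<open>\<rho> \<noteq> 0\<close> by auto
      \<comment> \<open>At the only index with nonzero \<open>a\<close>, the relation with
        \<open>e0 = 0\<close> forces \<open>s = 1 / \<theta> k\<close>. If all \<open>a i\<close>
        vanish, any square root serves.\<close>
      have "(1 / \<theta> k)\<^sup>2 = (2 - \<beta>) / \<rho>"
        using \<theta>k \<open>\<theta> k \<noteq> 0\<close> \<open>\<rho> \<noteq> 0\<close> by (simp add: field_simps)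
      moreover have "0 - a i + 1 / \<theta> k * a i * \<theta> i = 0" if "i \<le> d" for i
        using uniq[OF that k(1) _ k(2)] \<open>\<theta> k \<noteq> 0\<close> by (cases "a i = 0") auto
      ultimately have "(1 / \<theta> k)\<^sup>2 = (2 - \<beta>) / \<rho> \<and> (\<forall>i\<le>d. 0 - a i + (1 / \<theta> k) * a i * \<theta> i = 0)"
        by (intro conjI allI impI)
      then show ?thesis by - (rule exI, rule exI)
    next
      case False
      obtain s where "s\<^sup>2 = (2 - \<beta>) / \<rho>" using nth_root_exists[of 2 "(2 - \<beta>) / \<rho>"] by auto
      then show ?thesis using False by (intro exI[of _ s] exI[of _ 0]) auto
    qed
  next
    case False
    then have "f3 \<noteq> 0" "\<omega> \<noteq> 0" using c2 b by auto
    \<comment> \<open>Eliminating \<open>\<omega>\<close> and \<open>\<eta>\<close> from the three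
      coefficient equations shows that \<open>s = - f3 / f2\<close> has the required square.\<close>
    have "f0 * ((2 - \<beta>) * f2\<^sup>2 - \<rho> * f3\<^sup>2) = 0" using c0 c1 c2 by algebra
    then have sq: "(2 - \<beta>) * f2\<^sup>2 = \<rho> * f3\<^sup>2" using False by simp
    then have "f2 \<noteq> 0" using \<open>f3 \<noteq> 0\<close> \<open>\<rho> \<noteq> 0\<close> by auto
    have "(- f3 / f2)\<^sup>2 = (2 - \<beta>) / \<rho>"
      using sq \<open>f2 \<noteq> 0\<close> \<open>\<rho> \<noteq> 0\<close> by (simp add: field_simps)
    moreover have "- f0 / f2 - a i + (- f3 / f2) * a i * \<theta> i = 0" if "i \<le> d" for i
    proof -
      have "f2 * (- f0 / f2 - a i + (- f3 / f2) * a i * \<theta> i) = - (f0 + f1 * \<theta> i + f2 * a i + f3 * a i * \<theta> i)"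
        using \<open>f2 \<noteq> 0\<close> f1 by (simp add: field_simps)
      then show ?thesis using L[OF that] \<open>f2 \<noteq> 0\<close> by simp
    qed
    ultimately have "(- f3 / f2)\<^sup>2 = (2 - \<beta>) / \<rho> \<and> (\<forall>i\<le>d. - f0 / f2 - a i + (- f3 / f2) * a i * \<theta> i = 0)"
      by (intro conjI allI impI)
    then show ?thesis by - (rule exI, rule exI)
  qed
  then obtain s e0 where s: "s\<^sup>2 = (2 - \<beta>) / \<rho>" "\<And>i. i \<le> d \<Longrightarrow> e0 - a i + s * a i * \<theta> i = 0" by blast
  show ?thesis
    by (rule spin_parametersI[of d \<theta> \<beta> 0 \<rho> s "1 / \<rho>" 0 e0])
      (use P s \<open>\<rho> \<noteq> 0\<close> in auto)
qed

text \<open>For \<open>\<beta> \<noteq> 2\<close> a translation removes \<open>\<gamma>\<close>. For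
  \<open>\<beta> = 2\<close> and \<open>\<gamma> = 0\<close>, \<open>a\<close> is affine in
  \<open>\<theta>\<close>. For \<open>\<beta> = 2\<close> and \<open>\<gamma> \<noteq> 0\<close>,
  the cubic leaves only a relation in which \<open>a\<close> has twice the coefficient of
  \<open>\<theta>\<close>.\<close>

lemma spin_parameters_of_bilinear_relation:
  fixes \<theta> a :: "nat \<Rightarrow> 'a::alg_closed_field"
  assumes d: "d \<ge> 3" and inj: "inj_on \<theta> {..d}"
    and P: "\<And>i. i < d \<Longrightarrow> (\<theta> i)\<^sup>2 - \<beta> * \<theta> i * \<theta> (i + 1) + (\<theta> (i + 1))\<^sup>2 - \<gamma> * (\<theta> i + \<theta> (i + 1)) - \<rho> = 0"
    and N: "\<And>i. i \<le> d \<Longrightarrow> a i * ((2 - \<beta>) * (\<theta> i)\<^sup>2 - 2 * \<gamma> * \<theta> i - \<rho>) = \<gamma> * (\<theta> i)\<^sup>2 + \<omega> * \<theta> i + \<eta>"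
    and Q: "(2 - \<beta>) * \<theta> 0 * a 0 - \<gamma> * (\<theta> 0 + a 0) + \<rho> - \<omega> \<noteq> 0"
    and nz: "\<not> (f0 = 0 \<and> f1 = 0 \<and> f2 = 0 \<and> f3 = 0)"
    and L: "\<And>i. i \<le> d \<Longrightarrow> f0 + f1 * \<theta> i + f2 * a i + f3 * a i * \<theta> i = 0"
  shows "spin_parameters d \<theta> a"
proof -
  have ne: "\<theta> i \<noteq> \<theta> j" if "i \<noteq> j" "i \<le> d" "j \<le> d" for i j
    using inj_onD[OF inj, of i j] that by auto
  have interior: "(2 - \<beta>) * (\<theta> i)\<^sup>2 - 2 * \<gamma> * \<theta> i - \<rho> \<noteq> 0" if i: "0 < i" "i < d" for i
  proof -
    obtain k where k: "i = k + 1" using i(1) by (cases i) auto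
    define x y z where "x = \<theta> k" and "y = \<theta> (k + 1)" and "z = \<theta> (k + 2)"
    have P1: "x\<^sup>2 - \<beta> * x * y + y\<^sup>2 - \<gamma> * (x + y) - \<rho> = 0" and P2: "y\<^sup>2 - \<beta> * y * z + z\<^sup>2 - \<gamma> * (y + z) - \<rho> = 0"
      using P[of k] P[of "k + 1"] i by (simp_all add: k x_def y_def z_def)
    have neq: "x \<noteq> y" "y \<noteq> z" "x \<noteq> z" using ne i by (auto simp: k x_def y_def z_def)
    \<comment> \<open>Both neighbours of \<open>y\<close> are roots of the quadric with
      \<open>y\<close> fixed, which gives their sum. The quadric on the diagonal then factors as
      \<open>(y - x) * (y - z)\<close>.\<close>
    have "(x - z) * (x + z - (\<beta> * y + \<gamma>)) = 0" using P1 P2 by algebra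
    then have "x + z = \<beta> * y + \<gamma>" using neq by simp
    then have "(2 - \<beta>) * y\<^sup>2 - 2 * \<gamma> * y - \<rho> = (y - x) * (y - z)" using P1 by algebra
    then show ?thesis using neq by (simp add: k y_def)
  qed
  show ?thesis
  proof (cases "\<beta> = 2")
    case False
    \<comment> \<open>This is the centre of the symmetric quadric: after translation by
      \<open>m\<close> its linear terms disappear.\<close>
    define m where "m = \<gamma> / (2 - \<beta>)"
    have m: "\<gamma> = (2 - \<beta>) * m" using False by (simp add: m_def)
    define \<rho>' where "\<rho>' = \<rho> + \<gamma> * m"
    define \<omega>' where "\<omega>' = \<omega> + 2 * \<gamma> * m"
    define \<eta>' where "\<eta>' = \<eta> + m * \<rho> + \<omega>' * m"
    show ?thesis
    proof (rule spin_parameters_translate, rule spin_parameters_centered)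
      show "inj_on (\<lambda>i. \<theta> i - m) {..d}" using inj by (simp add: inj_on_def)
      show "(\<theta> i - m)\<^sup>2 - \<beta> * (\<theta> i - m) * (\<theta> (i + 1) - m) + (\<theta> (i + 1) - m)\<^sup>2 - \<rho>' = 0" if "i < d" for i
        using P[OF that] m unfolding \<rho>'_def by algebra
      have shift: "(2 - \<beta>) * (x - m)\<^sup>2 - \<rho>' = (2 - \<beta>) * x\<^sup>2 - 2 * \<gamma> * x - \<rho>" for x
        using m unfolding \<rho>'_def by algebra
      show "(a i - m) * ((2 - \<beta>) * (\<theta> i - m)\<^sup>2 - \<rho>') = \<omega>' * (\<theta> i - m) + \<eta>'" if "i \<le> d" for i
        using N[OF that] m unfolding shift \<omega>'_def \<eta>'_def by algebra
      show "(2 - \<beta>) * (\<theta> i - m)\<^sup>2 - \<rho>' \<noteq> 0" if "0 < i" "i < d" for i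
        using interior[OF that] unfolding shift .
      have "(2 - \<beta>) * (\<theta> 0 - m) * (a 0 - m) + \<rho>' - \<omega>' =
          (2 - \<beta>) * \<theta> 0 * a 0 - \<gamma> * (\<theta> 0 + a 0) + \<rho> - \<omega>"
        using m unfolding \<rho>'_def \<omega>'_def by algebra
      then show "(2 - \<beta>) * (\<theta> 0 - m) * (a 0 - m) + \<rho>' - \<omega>' \<noteq> 0" using Q by simp
      let ?g0 = "f0 + f1 * m + f2 * m + f3 * m * m"
      show "\<not> (?g0 = 0 \<and> f1 + f3 * m = 0 \<and> f2 + f3 * m = 0 \<and> f3 = 0)"
        using nz by auto
      show "?g0 + (f1 + f3 * m) * (\<theta> i - m) + (f2 + f3 * m) * (a i - m) + f3 * (a i - m) * (\<theta> i - m) = 0"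
        if "i \<le> d" for i
        using L[OF that] by algebra
    qed (use d False in auto)
  next
    case True
    show ?thesis
    proof (cases "\<gamma> = 0")
      case True
      then have "\<rho> \<noteq> 0" using interior[of 1] \<open>\<beta> = 2\<close> d by simp
      have "\<rho> - \<omega> \<noteq> 0" using Q True \<open>\<beta> = 2\<close> by simp
      \<comment> \<open>Here \<open>a\<close> equals
        \<open>- (\<omega> * \<theta> + \<eta>) / \<rho>\<close>. Substituting this with
        \<open>s = 0\<close> and comparing the coefficients of \<open>\<theta>\<close> yields
        \<open>e1\<close>, the constant terms yield \<open>e0\<close>.\<close>
      define e1 where "e1 = - \<omega> / (\<rho> - \<omega>)"
      have e1: "e1 * (\<rho> - \<omega>) = - \<omega>" using \<open>\<rho> - \<omega> \<noteq> 0\<close> by (simp add: e1_def)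
      define e0 where "e0 = (e1 - 1) * \<eta> / \<rho>"
      have e0: "\<rho> * e0 = (e1 - 1) * \<eta>" using \<open>\<rho> \<noteq> 0\<close> by (simp add: e0_def)
      show ?thesis
      proof (rule spin_parametersI[where \<beta> = \<beta> and \<gamma> = \<gamma> and \<rho> = \<rho> and s = 0 and p = "(1 - e1\<^sup>2) / \<rho>" and ?e0.0 = e0 and ?e1.0 = e1])
        show "e1\<^sup>2 - 1 = - \<rho> * ((1 - e1\<^sup>2) / \<rho>)" using \<open>\<rho> \<noteq> 0\<close> by simp
        fix i assume "i \<le> d"
        then have "- \<rho> * a i = \<omega> * \<theta> i + \<eta>" using N[of i] True \<open>\<beta> = 2\<close> by (simp add: algebra_simps)
        then have "\<rho> * (e0 + (e1 - 1) * a i + e1 * \<theta> i + 0 * a i * \<theta> i) = 0"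
          using e0 e1 by algebra
        then show "e0 + (e1 - 1) * a i + e1 * \<theta> i + 0 * a i * \<theta> i = 0" using \<open>\<rho> \<noteq> 0\<close> by simp
      qed (use P True \<open>\<beta> = 2\<close> in auto)
    next
      case False
      note coeffs = cubic_eq_zero[where x = \<theta>, OF d inj cubic_relation[where a = "a _", OF N L]]
      have f3: "f3 = 0" using coeffs False \<open>\<beta> = 2\<close> by simp
      have "\<gamma> * (f2 - 2 * f1) = 0" using coeffs f3 \<open>\<beta> = 2\<close> by (simp add: algebra_simps)
      then have f2: "f2 = 2 * f1" using False by simp
      have "f1 \<noteq> 0" using nz f2 f3 L[of 0] by auto
      show ?thesis
      \<comment> \<open>The choice \<open>e1 = - 1\<close> turns the required relation into
        \<open>e0 = 2 * a i + \<theta> i\<close>, a multiple of the given one.\<close>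
      proof (rule spin_parametersI[where \<beta> = \<beta> and \<gamma> = \<gamma> and \<rho> = \<rho> and s = 0 and p = 0 and ?e0.0 = "- f0 / f1" and ?e1.0 = "- 1"])
        fix i assume "i \<le> d"
        have "f1 * (- f0 / f1 + (- 1 - 1) * a i + - 1 * \<theta> i + 0 * a i * \<theta> i) = - (f0 + f1 * \<theta> i + f2 * a i + f3 * a i * \<theta> i)"
          using \<open>f1 \<noteq> 0\<close> f2 f3 by (simp add: field_simps)
        then show "- f0 / f1 + (- 1 - 1) * a i + - 1 * \<theta> i + 0 * a i * \<theta> i = 0"
          using L[OF \<open>i \<le> d\<close>] \<open>f1 \<noteq> 0\<close> by simp
      qed (use P in auto)
    qed
  qed
qed

subsection \<open>Coordinates\<close>

context endo_space
begin

lemma End_space_add: "F \<in> End_space \<Longrightarrow> F (x + y) = F x + F y"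
  and End_space_scale: "F \<in> End_space \<Longrightarrow> F (c *s x) = c *s F x"
  and End_space_diff: "F \<in> End_space \<Longrightarrow> F (x - y) = F x - F y"
  and End_space_zero: "F \<in> End_space \<Longrightarrow> F 0 = 0"
  and End_space_sum: "F \<in> End_space \<Longrightarrow> F (sum g I) = (\<Sum>i\<in>I. F (g i))"
  by (auto simp: linear_iff_module_hom module_hom.add module_hom.scale module_hom.diff
      module_hom.zero module_hom.sum)

lemma End_spaceI:
  assumes "\<And>x y. F (x + y) = F x + F y" "\<And>c x. F (c *s x) = c *s F x"
  shows "F \<in> End_space"
  using assms by (auto simp: linear_iff_module_hom intro!: module_hom.intro module_hom_axioms.intro module_axioms)

lemma End_space_comp:
  assumes "F \<in> End_space" "G \<in> End_space"
  shows "F \<circ> G \<in> End_space"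
  by (rule End_spaceI) (simp_all add: End_space_add[OF assms(1)] End_space_scale[OF assms(1)]
      End_space_add[OF assms(2)] End_space_scale[OF assms(2)])

definition coord :: "nat \<Rightarrow> (nat \<Rightarrow> 'b) \<Rightarrow> nat \<Rightarrow> 'b \<Rightarrow> 'a" where
  "coord d v i x = representation (v ` {..d}) x (v i)"

definition diagonal_map :: "nat \<Rightarrow> (nat \<Rightarrow> 'b) \<Rightarrow> (nat \<Rightarrow> 'a) \<Rightarrow> 'b \<Rightarrow> 'b" where
  "diagonal_map d v t x = (\<Sum>i\<le>d. (t i * coord d v i x) *s v i)"

context
  fixes d :: nat and v :: "nat \<Rightarrow> 'b"
  assumes basis: "ordered_basis d v"
begin

lemma coord_add: "coord d v i (x + y) = coord d v i x + coord d v i y"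
  and coord_diff: "coord d v i (x - y) = coord d v i x - coord d v i y"
  and coord_scale: "coord d v i (c *s x) = c * coord d v i x"
  and coord_zero: "coord d v i 0 = 0"
  using basis
  by (auto simp: ordered_basis_def coord_def representation_add representation_diff
      representation_scale representation_zero)

lemma coord_sum: "coord d v i (sum g I) = (\<Sum>k\<in>I. coord d v i (g k))"
  by (induction I rule: infinite_finite_induct) (auto simp: coord_add coord_zero)

lemma coord_basis: "i \<le> d \<Longrightarrow> j \<le> d \<Longrightarrow> coord d v i (v j) = (if i = j then 1 else 0)"
  using basis by (auto simp: ordered_basis_def coord_def representation_basis dest: inj_onD)

lemma coord_expand: "(\<Sum>i\<le>d. coord d v i x *s v i) = x"
proof -
  have "(\<Sum>i\<le>d. coord d v i x *s v i) = (\<Sum>b\<in>v ` {..d}. representation (v ` {..d}) x b *s b)"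
    using basis by (simp add: ordered_basis_def coord_def sum.reindex)
  also have "\<dots> = x"
    using basis by (intro sum_representation_eq) (auto simp: ordered_basis_def)
  finally show ?thesis .
qed

lemma coord_eqI:
  assumes "\<And>i. i \<le> d \<Longrightarrow> coord d v i x = coord d v i y"
  shows "x = y"
proof -
  have "(\<Sum>i\<le>d. coord d v i x *s v i) = (\<Sum>i\<le>d. coord d v i y *s v i)"
    using assms by (intro sum.cong) auto
  then show ?thesis by (simp only: coord_expand)
qed

lemma End_space_expand:
  assumes "F \<in> End_space"
  shows "F x = (\<Sum>j\<le>d. coord d v j x *s F (v j))"
proof -
  have "F x = F (\<Sum>i\<le>d. coord d v i x *s v i)" by (simp only: coord_expand)
  also have "\<dots> = (\<Sum>j\<le>d. coord d v j x *s F (v j))"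
    using assms by (simp only: End_space_sum End_space_scale)
  finally show ?thesis .
qed

lemma End_space_eqI:
  assumes F: "F \<in> End_space" and G: "G \<in> End_space" and eq: "\<And>j. j \<le> d \<Longrightarrow> F (v j) = G (v j)"
  shows "F = G"
proof
  show "F x = G x" for x
    unfolding End_space_expand[OF F, of x] End_space_expand[OF G, of x]
    using eq by (intro sum.cong) auto
qed

lemma coord_End_space:
  assumes "F \<in> End_space"
  shows "coord d v i (F x) = (\<Sum>j\<le>d. coord d v i (F (v j)) * coord d v j x)"
  unfolding End_space_expand[OF assms, of x] by (simp add: coord_sum coord_scale mult.commute)

lemma coord_sum_basis: "i \<le> d \<Longrightarrow> coord d v i (\<Sum>j\<le>d. c j *s v j) = c i"
  by (simp add: coord_sum coord_scale coord_basis if_distrib[of "(*) _"] sum.delta cong: if_cong)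

lemma coord_diagonal_map: "i \<le> d \<Longrightarrow> coord d v i (diagonal_map d v t x) = t i * coord d v i x"
  unfolding diagonal_map_def by (rule coord_sum_basis)

lemma diagonal_map_basis: "j \<le> d \<Longrightarrow> diagonal_map d v t (v j) = t j *s v j"
  by (rule coord_eqI) (simp add: coord_diagonal_map coord_scale coord_basis)

lemma diagonal_map_End_space: "diagonal_map d v t \<in> End_space"
  by (rule End_spaceI; rule coord_eqI)
    (simp_all add: coord_diagonal_map coord_scale coord_add algebra_simps)

lemma bij_diagonal_map:
  assumes "\<And>i. i \<le> d \<Longrightarrow> t i \<noteq> 0"
  shows "bij (diagonal_map d v t)"
proof (rule o_bij)
  show "diagonal_map d v (\<lambda>i. inverse (t i)) \<circ> diagonal_map d v t = id"
    "diagonal_map d v t \<circ> diagonal_map d v (\<lambda>i. inverse (t i)) = id"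
    using assms by (auto simp: fun_eq_iff coord_diagonal_map intro!: coord_eqI)
qed

lemma coord_eigenvectors:
  assumes "F \<in> End_space" "\<And>j. j \<le> d \<Longrightarrow> F (v j) = t j *s v j" "i \<le> d"
  shows "coord d v i (F x) = t i * coord d v i x"
proof -
  have "F = diagonal_map d v t"
    by (rule End_space_eqI[OF assms(1) diagonal_map_End_space]) (simp add: assms(2) diagonal_map_basis)
  then show ?thesis using assms(3) by (simp add: coord_diagonal_map)
qed

lemma trace_map_eq_sum:
  assumes "F \<in> End_space"
  shows "trace_map F = (\<Sum>i\<le>d. coord d v i (F (v i)))"
proof -
  let ?C = "v ` {..d}"
  have C: "independent ?C" "span ?C = UNIV" "finite ?C" using basis by (auto simp: ordered_basis_def)
  define B where "B = (SOME B. independent B \<and> span B = UNIV)"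
  have B: "independent B \<and> span B = UNIV"
    unfolding B_def by (rule someI[of "\<lambda>B. independent B \<and> span B = UNIV" ?C]) (simp add: C)
  \<comment> \<open>The basis chosen inside \<open>trace_map\<close> is arbitrary, so its finiteness
    has to come from the finite basis \<open>?C\<close>.\<close>
  have "finite B" using independent_span_bound[of ?C B] B C by auto
  then have "trace_map F = (\<Sum>b\<in>?C. representation ?C (F b) b)"
    unfolding trace_map_def Let_def B_def[symmetric]
    using assms B C by (intro trace_basis_independent) auto
  then show ?thesis
    using basis by (simp add: ordered_basis_def coord_def sum.reindex)
qed

end

lemma End_space_inv:
  assumes "F \<in> End_space" "bij F"
  shows "inv F \<in> End_space"
proof (rule End_spaceI)
  have F: "F (inv F x) = x" for x using assms(2) by (simp add: bij_is_surj surj_f_inv_f)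
  have inj: "inj F" using assms(2) by (rule bij_is_inj)
  show "inv F (x + y) = inv F x + inv F y" for x y
    by (rule injD[OF inj]) (simp add: F End_space_add[OF assms(1)])
  show "inv F (c *s x) = c *s inv F x" for c x
    by (rule injD[OF inj]) (simp add: F End_space_scale[OF assms(1)])
qed

section \<open>Eigenvectors of tridiagonal matrices and of commuting maps\<close>

lemma irreducible_tridiagonal_transpose:
  "irreducible_tridiagonal d M \<Longrightarrow> irreducible_tridiagonal d (\<lambda>i j. M j i)"
  by (auto simp: irreducible_tridiagonal_def)

text \<open>Since the superdiagonal has no zeros, row \<open>k\<close> of the eigenvector equation
  determines entry \<open>k + 1\<close> from the earlier ones, so the first entry determines the
  whole vector.\<close>

lemma irreducible_tridiagonal_eigenvector_zero:
  assumes M: "irreducible_tridiagonal d M"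
    and ev: "\<And>i. i \<le> d \<Longrightarrow> (\<Sum>j\<le>d. M i j * c j) = t * c i"
    and c0: "c 0 = 0"
  shows "i \<le> d \<Longrightarrow> c i = 0"
proof (induction i rule: less_induct)
  case (less i)
  show ?case
  proof (cases i)
    case 0
    then show ?thesis using c0 by simp
  next
    case (Suc k)
    have "(\<Sum>j\<le>d. M k j * c j) = M k i * c i"
    proof (rule trans[OF sum.mono_neutral_right[of "{..d}" "{i}"]])
      show "\<forall>j\<in>{..d} - {i}. M k j * c j = 0"
      proof
        fix j assume j: "j \<in> {..d} - {i}"
        consider "j < i" | "k + 1 < j" using j Suc by force
        then show "M k j * c j = 0"
        proof cases
          case 1
          then show ?thesis using less.IH[of j] j by simp
        next
          case 2
          then show ?thesis using M j less.prems Suc by (simp add: irreducible_tridiagonal_def)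
        qed
      qed
    qed (use less.prems in auto)
    then have "M k i * c i = t * c k" using ev[of k] less.prems Suc by simp
    moreover have "c k = 0" using less.IH[of k] less.prems Suc by simp
    moreover have "M k i \<noteq> 0" using M less.prems Suc by (auto simp: irreducible_tridiagonal_def)
    ultimately show ?thesis by simp
  qed
qed

text \<open>A map commuting with \<open>D\<close> preserves the eigenspaces of \<open>D\<close>,
  which are lines because the eigenvalues are distinct.\<close>

lemma commuting_eigenvectors:
  assumes w: "ordered_basis d w" and F: "F \<in> End_space" and D: "D \<in> End_space"
    and eig: "\<And>j. j \<le> d \<Longrightarrow> D (w j) = \<theta> j *s w j" and inj: "inj_on \<theta> {..d}"
    and comm: "F \<circ> D = D \<circ> F" and j: "j \<le> d"
  shows "F (w j) = coord d w j (F (w j)) *s w j"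
proof (rule coord_eqI[OF w])
  fix i assume i: "i \<le> d"
  have "\<theta> i * coord d w i (F (w j)) = coord d w i (D (F (w j)))"
    by (rule coord_eigenvectors[OF w D eig i, symmetric])
  also have "D (F (w j)) = F (\<theta> j *s w j)" using comm eig[OF j] by (metis comp_apply)
  also have "coord d w i \<dots> = \<theta> j * coord d w i (F (w j))"
    by (simp add: End_space_scale[OF F] coord_scale[OF w])
  finally have "(\<theta> i - \<theta> j) * coord d w i (F (w j)) = 0" by (simp add: algebra_simps)
  then show "coord d w i (F (w j)) = coord d w i (coord d w j (F (w j)) *s w j)"
    using inj_onD[OF inj, of i j] i j by (cases "i = j") (auto simp: coord_scale[OF w] coord_basis[OF w])
qed

lemma basis_nonzero: "ordered_basis d w \<Longrightarrow> j \<le> d \<Longrightarrow> w j \<noteq> 0"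
  using coord_basis[of d w j j] coord_zero[of d w j] by auto

lemma commuting_bij_eigenvectors:
  assumes w: "ordered_basis d w" and F: "F \<in> End_space" "bij F" and D: "D \<in> End_space"
    and eig: "\<And>j. j \<le> d \<Longrightarrow> D (w j) = \<theta> j *s w j" and inj: "inj_on \<theta> {..d}"
    and comm: "F \<circ> D = D \<circ> F"
  obtains t where "\<And>j. j \<le> d \<Longrightarrow> t j \<noteq> 0" "\<And>j. j \<le> d \<Longrightarrow> F (w j) = t j *s w j"
    "\<And>j. j \<le> d \<Longrightarrow> inv F (w j) = (1 / t j) *s w j"
proof -
  define t where "t j = coord d w j (F (w j))" for j
  have F_w: "F (w j) = t j *s w j" if "j \<le> d" for j
    unfolding t_def by (rule commuting_eigenvectors[OF w F(1) D eig inj comm that])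
  have nz: "t j \<noteq> 0" if "j \<le> d" for j
  proof
    assume "t j = 0"
    then have "F (w j) = F 0" using F_w[OF that] by (simp add: End_space_zero[OF F(1)])
    then have "w j = 0" by (rule injD[OF bij_is_inj[OF F(2)]])
    then show False using basis_nonzero[OF w that] by simp
  qed
  have "inv F (w j) = (1 / t j) *s w j" if "j \<le> d" for j
    using nz[OF that] by (intro inv_f_eq[OF bij_is_inj[OF F(2)]])
      (simp add: End_space_scale[OF F(1)] F_w[OF that])
  then show thesis using that nz F_w by blast
qed

end

subsection \<open>Self-dual Leonard systems in coordinates\<close>

text \<open>
  The data of a self-dual Leonard system in coordinates: \<open>u\<close> and \<open>v\<close> are eigenbases of \<open>A\<close> and
  \<open>As\<close>, both with eigenvalues \<open>\<theta>\<close>, and \<open>a\<close> is the diagonal of \<open>A\<close> in \<open>v\<close> and of \<open>As\<close> in \<open>u\<close>.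
\<close>

locale self_dual_frame = endo_space scale
  for scale :: "'a::field \<Rightarrow> 'b::ab_group_add \<Rightarrow> 'b" (infixr \<open>*s\<close> 75) +
  fixes d :: nat and A As :: "'b \<Rightarrow> 'b" and u v :: "nat \<Rightarrow> 'b" and \<theta> a :: "nat \<Rightarrow> 'a"
  assumes d3: "d \<ge> 3"
    and A: "A \<in> End_space" and As: "As \<in> End_space"
    and leonard_u: "leonard_basis d As A u" and leonard_v: "leonard_basis d A As v"
    and inj: "inj_on \<theta> {..d}"
    and A_u: "i \<le> d \<Longrightarrow> A (u i) = \<theta> i *s u i"
    and As_v: "i \<le> d \<Longrightarrow> As (v i) = \<theta> i *s v i"
    and diag_v: "i \<le> d \<Longrightarrow> matrix_entry d v A i i = a i"
    and diag_u: "i \<le> d \<Longrightarrow> matrix_entry d u As i i = a i"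
begin

abbreviation "cu \<equiv> coord d u"
abbreviation "cv \<equiv> coord d v"
abbreviation "T \<equiv> matrix_entry d v A"
abbreviation "Ts \<equiv> matrix_entry d u As"

lemma basis_u: "ordered_basis d u" and basis_v: "ordered_basis d v"
  and tri_v: "irreducible_tridiagonal d T" and tri_u: "irreducible_tridiagonal d Ts"
  using leonard_u leonard_v by (auto simp: leonard_basis_def)

lemma theta_neq: "i \<noteq> j \<Longrightarrow> i \<le> d \<Longrightarrow> j \<le> d \<Longrightarrow> \<theta> i \<noteq> \<theta> j"
  using inj by (auto dest: inj_onD)

lemma T_zero: "i \<le> d \<Longrightarrow> j \<le> d \<Longrightarrow> i + 1 < j \<or> j + 1 < i \<Longrightarrow> T i j = 0"
  and T_nonzero: "i < d \<Longrightarrow> T i (i + 1) \<noteq> 0" "i < d \<Longrightarrow> T (i + 1) i \<noteq> 0"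
  using tri_v by (auto simp: irreducible_tridiagonal_def)

lemma Ts_zero: "i \<le> d \<Longrightarrow> j \<le> d \<Longrightarrow> i + 1 < j \<or> j + 1 < i \<Longrightarrow> Ts i j = 0"
  using tri_u by (auto simp: irreducible_tridiagonal_def)

lemmas cu_simps = coord_add[OF basis_u] coord_diff[OF basis_u] coord_scale[OF basis_u]
  coord_zero[OF basis_u] coord_basis[OF basis_u]
lemmas cv_simps = coord_add[OF basis_v] coord_diff[OF basis_v] coord_scale[OF basis_v]
  coord_zero[OF basis_v] coord_basis[OF basis_v]
lemmas A_simps = End_space_add[OF A] End_space_scale[OF A] End_space_diff[OF A] End_space_zero[OF A]
lemmas As_simps = End_space_add[OF As] End_space_scale[OF As] End_space_diff[OF As] End_space_zero[OF As]

lemma cv_A_v: "cv i (A (v j)) = T i j" and cu_As_u: "cu i (As (u j)) = Ts i j"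
  by (simp_all add: coord_def matrix_entry_def)

lemma cu_A: "i \<le> d \<Longrightarrow> cu i (A x) = \<theta> i * cu i x"
  by (rule coord_eigenvectors[OF basis_u A A_u])

lemma cv_As: "i \<le> d \<Longrightarrow> cv i (As x) = \<theta> i * cv i x"
  by (rule coord_eigenvectors[OF basis_v As As_v])

lemma cu_As: "cu i (As x) = (\<Sum>j\<le>d. Ts i j * cu j x)"
  using coord_End_space[OF basis_u As, of i x] by (simp add: cu_As_u)

lemma cv_A: "cv i (A x) = (\<Sum>j\<le>d. T i j * cv j x)"
  using coord_End_space[OF basis_v A, of i x] by (simp add: cv_A_v)

text \<open>The values of the functional \<open>cu i\<close> on the basis \<open>v\<close> form an
  eigenvector of the transpose of \<open>T\<close>; a zero first entry would make the functional
  vanish.\<close>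

lemma cu_v0_nonzero:
  assumes i: "i \<le> d"
  shows "cu i (v 0) \<noteq> 0"
proof
  assume zero: "cu i (v 0) = 0"
  have lin: "cu i x = (\<Sum>k\<le>d. cv k x * cu i (v k))" for x
  proof -
    have "cu i (\<Sum>k\<le>d. cv k x *s v k) = (\<Sum>k\<le>d. cv k x * cu i (v k))"
      by (simp add: coord_sum[OF basis_u] cu_simps)
    then show ?thesis by (simp only: coord_expand[OF basis_v])
  qed
  have "cu i (v j) = 0" if "j \<le> d" for j
  proof (rule irreducible_tridiagonal_eigenvector_zero
      [OF irreducible_tridiagonal_transpose[OF tri_v], where c = "\<lambda>k. cu i (v k)" and t = "\<theta> i"])
    fix j assume "j \<le> d"
    show "(\<Sum>k\<le>d. T k j * cu i (v k)) = \<theta> i * cu i (v j)"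
      using lin[of "A (v j)"] by (simp add: cu_A[OF i] cv_A_v)
  qed (use zero that in auto)
  then have "cu i (u i) = 0" using lin[of "u i"] by simp
  then show False using i by (simp add: cu_simps)
qed

text \<open>The coordinates of \<open>u i\<close> in the basis \<open>v\<close> form an eigenvector
  of \<open>T\<close>, so a zero first entry would give \<open>u i = 0\<close>.\<close>

lemma cv0_u_nonzero:
  assumes i: "i \<le> d"
  shows "cv 0 (u i) \<noteq> 0"
proof
  assume zero: "cv 0 (u i) = 0"
  have "cv k (u i) = 0" if "k \<le> d" for k
  proof (rule irreducible_tridiagonal_eigenvector_zero
      [OF tri_v, where c = "\<lambda>k. cv k (u i)" and t = "\<theta> i"])
    fix k assume "k \<le> d"
    show "(\<Sum>j\<le>d. T k j * cv j (u i)) = \<theta> i * cv k (u i)"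
      using cv_A[of k "u i"] by (simp add: A_u[OF i] cv_simps)
  qed (use zero that in auto)
  then have "u i = 0" by (intro coord_eqI[OF basis_v]) (simp add: cv_simps)
  then show False using basis_nonzero[OF basis_u i] by simp
qed

section \<open>The filtration generated by \<open>v 0\<close>\<close>

text \<open>Level \<open>k\<close> is membership in the span of \<open>v 0\<close>, ...,
  \<open>v k\<close>. For \<open>k \<le> d\<close> this is also the space of polynomials of degree
  at most \<open>k\<close> in \<open>A\<close>, applied to \<open>v 0\<close>.\<close>

definition level :: "nat \<Rightarrow> 'b \<Rightarrow> bool" where
  "level k x \<longleftrightarrow> (\<forall>j\<le>d. k < j \<longrightarrow> cv j x = 0)"

lemma level_A: "level k x \<Longrightarrow> level (Suc k) (A x)"
  unfolding level_def
proof (intro allI impI)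
  fix j assume x: "\<forall>j\<le>d. k < j \<longrightarrow> cv j x = 0" and j: "j \<le> d" "Suc k < j"
  show "cv j (A x) = 0"
    unfolding cv_A
  proof (intro sum.neutral ballI)
    fix l assume l: "l \<in> {..d}"
    show "T j l * cv l x = 0"
      using x l T_zero[of j l] j by (cases "l \<le> k") auto
  qed
qed

lemma level_As: "level k x \<Longrightarrow> level k (As x)"
  by (simp add: level_def cv_As)

lemma level_add: "level k x \<Longrightarrow> level k y \<Longrightarrow> level k (x + y)"
  and level_diff: "level k x \<Longrightarrow> level k y \<Longrightarrow> level k (x - y)"
  and level_scale: "level k x \<Longrightarrow> level k (c *s x)"
  by (simp_all add: level_def cv_simps)

lemma level_mono: "level k x \<Longrightarrow> k \<le> l \<Longrightarrow> level l x"
  by (auto simp: level_def)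

lemma level_v0: "level 0 (v 0)"
  by (simp add: level_def cv_simps)

lemma level_power: "level k ((A ^^ k) (v 0))"
  by (induction k) (auto simp: level_v0 level_A)

lemma cu_power: "i \<le> d \<Longrightarrow> cu i ((A ^^ k) (v 0)) = \<theta> i ^ k * cu i (v 0)"
  by (induction k) (auto simp: cu_A)

text \<open>Each application of \<open>A\<close> multiplies the top coordinate by a nonzero
  subdiagonal entry of \<open>T\<close>.\<close>

lemma cv_power_nonzero: "k \<le> d \<Longrightarrow> cv k ((A ^^ k) (v 0)) \<noteq> 0"
proof (induction k)
  case 0
  then show ?case by (simp add: cv_simps)
next
  case (Suc k)
  let ?x = "(A ^^ k) (v 0)"
  have "cv (Suc k) (A ?x) = T (Suc k) k * cv k ?x"
    unfolding cv_A
  proof (rule trans[OF sum.mono_neutral_right[of "{..d}" "{k}"]])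
    show "\<forall>l\<in>{..d} - {k}. T (Suc k) l * cv l ?x = 0"
    proof
      fix l assume l: "l \<in> {..d} - {k}"
      then consider "l < k" | "k < l" by force
      then show "T (Suc k) l * cv l ?x = 0"
      proof cases
        case 1
        then show ?thesis using T_zero[of "Suc k" l] Suc.prems l by simp
      next
        case 2
        then show ?thesis using level_power[of k] l by (simp add: level_def)
      qed
    qed
  qed (use Suc.prems in auto)
  then show ?case using Suc T_nonzero(2)[of k] by simp
qed

text \<open>Subtracting a multiple of \<open>(A ^^ k) (v 0)\<close> lowers the level, and powers of
  \<open>A\<close> act on \<open>cu i\<close> as powers of \<open>\<theta> i\<close>. Bounds on the
  level thus become bounds on the degree in \<open>\<theta>\<close>.\<close>

lemma level_polynomial:
  "level k x \<Longrightarrow> k \<le> d \<Longrightarrow> \<exists>c. \<forall>i\<le>d. cu i x = (\<Sum>j\<le>k. c j * \<theta> i ^ j) * cu i (v 0)"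
proof (induction k arbitrary: x)
  case 0
  have "x = cv 0 x *s v 0"
    using 0 by (intro coord_eqI[OF basis_v]) (auto simp: cv_simps level_def)
  then have "cu i x = cu i (cv 0 x *s v 0)" for i by (rule arg_cong)
  then have "\<forall>i\<le>d. cu i x = (\<Sum>j\<le>0. cv 0 x * \<theta> i ^ j) * cu i (v 0)"
    by (simp only: coord_scale[OF basis_u]) simp
  then show ?case by (rule exI[of _ "\<lambda>_. cv 0 x"])
next
  case (Suc k)
  let ?w = "(A ^^ Suc k) (v 0)"
  define r where "r = cv (Suc k) x / cv (Suc k) ?w"
  have "level k (x - r *s ?w)"
    unfolding level_def
  proof (intro allI impI)
    fix j assume j: "j \<le> d" "k < j"
    show "cv j (x - r *s ?w) = 0"
    proof (cases "j = Suc k")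
      case True
      then show ?thesis using cv_power_nonzero[OF Suc.prems(2)] by (simp add: cv_simps r_def)
    next
      case False
      then have "Suc k < j" using j by simp
      then show ?thesis
        using Suc.prems(1) level_power[of "Suc k"] j by (simp add: cv_simps level_def)
    qed
  qed
  then obtain c where c: "\<And>i. i \<le> d \<Longrightarrow> cu i (x - r *s ?w) = (\<Sum>j\<le>k. c j * \<theta> i ^ j) * cu i (v 0)"
    using Suc.IH[of "x - r *s ?w"] Suc.prems(2) by auto
  have "cu i x = (\<Sum>j\<le>Suc k. (if j = Suc k then r else c j) * \<theta> i ^ j) * cu i (v 0)" if i: "i \<le> d" for i
  proof -
    have "cu i x = (\<Sum>j\<le>k. c j * \<theta> i ^ j) * cu i (v 0) + r * cu i ?w"
      using c[OF i] by (simp add: cu_simps algebra_simps)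
    also have "(\<Sum>j\<le>k. c j * \<theta> i ^ j) = (\<Sum>j\<le>k. (if j = Suc k then r else c j) * \<theta> i ^ j)"
      by (intro sum.cong) auto
    finally show ?thesis by (simp only: cu_power[OF i] sum.atMost_Suc) (simp add: algebra_simps)
  qed
  then have "\<forall>i\<le>d. cu i x = (\<Sum>j\<le>Suc k. (if j = Suc k then r else c j) * \<theta> i ^ j) * cu i (v 0)"
    by simp
  then show ?case by (rule exI[of _ "\<lambda>j. if j = Suc k then r else c j"])
qed

lemma cu_As_A: "cu i (As (A x)) = (\<Sum>j\<le>d. Ts i j * (\<theta> j * cu j x))"
  unfolding cu_As by (auto intro!: sum.cong simp: cu_A)

lemma cu_As_A_A: "cu i (As (A (A x))) = (\<Sum>j\<le>d. Ts i j * (\<theta> j * (\<theta> j * cu j x)))"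
  unfolding cu_As by (auto intro!: sum.cong simp: cu_A)

text \<open>
  The operator \<open>Z\<close>, diagonal in \<open>u\<close>, is chosen so that \<open>Z As - As Z = A\<^sup>2 As A - A As A\<^sup>2\<close>; hence
  it raises the level by at most \<open>3\<close> and its eigenvalues are a cubic polynomial in \<open>\<theta>\<close>, whose first
  differences give the quadric.
\<close>

lemma eigenvalue_quadric:
  "\<exists>\<beta> \<gamma> \<rho>. \<forall>i<d. (\<theta> i)\<^sup>2 - \<beta> * \<theta> i * \<theta> (i + 1) + (\<theta> (i + 1))\<^sup>2 - \<gamma> * (\<theta> i + \<theta> (i + 1)) - \<rho> = 0"
proof -
  \<comment> \<open>Since \<open>Ts\<close> is tridiagonal, the commutator identity constrains
    \<open>z\<close> only through differences at neighbouring indices, and these can be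
    summed.\<close>
  define z where "z i = (\<Sum>k<i. \<theta> k * \<theta> (k + 1) * (\<theta> (k + 1) - \<theta> k))" for i
  have z_Suc: "z (i + 1) = z i + \<theta> i * \<theta> (i + 1) * (\<theta> (i + 1) - \<theta> i)" for i
    by (simp add: z_def)
  define Z where "Z = diagonal_map d u z"
  have cu_Z: "cu i (Z x) = z i * cu i x" if "i \<le> d" for i x
    unfolding Z_def by (rule coord_diagonal_map[OF basis_u that])
  have comm: "Z (As x) - As (Z x) = A (A (As (A x))) - A (As (A (A x)))" for x
  proof (rule coord_eqI[OF basis_u])
    fix i assume i: "i \<le> d"
    have "cu i (As (Z x)) = (\<Sum>j\<le>d. Ts i j * (z j * cu j x))"
      unfolding cu_As by (intro sum.cong) (auto simp: cu_Z)
    then have "cu i (Z (As x) - As (Z x)) = (\<Sum>j\<le>d. z i * (Ts i j * cu j x) - Ts i j * (z j * cu j x))"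
      by (simp add: cu_simps cu_Z[OF i] cu_As sum_distrib_left sum_subtractf)
    also have "\<dots> = (\<Sum>j\<le>d. \<theta> i * (\<theta> i * (Ts i j * (\<theta> j * cu j x))) - \<theta> i * (Ts i j * (\<theta> j * (\<theta> j * cu j x))))"
    proof (rule sum.cong[OF refl])
      fix j assume "j \<in> {..d}"
      then consider "j = i" | "j = i + 1" | "i = j + 1" | "Ts i j = 0"
        using Ts_zero[of i j] i by force
      then show "z i * (Ts i j * cu j x) - Ts i j * (z j * cu j x) =
          \<theta> i * (\<theta> i * (Ts i j * (\<theta> j * cu j x))) - \<theta> i * (Ts i j * (\<theta> j * (\<theta> j * cu j x)))"
        by cases (simp_all add: z_Suc[simplified] algebra_simps)
    qed
    also have "\<dots> = cu i (A (A (As (A x))) - A (As (A (A x))))"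
      by (simp add: cu_simps cu_A[OF i] cu_As_A[of i x] cu_As_A_A[of i x] sum_distrib_left sum_subtractf)
    finally show "cu i (Z (As x) - As (Z x)) = cu i (A (A (As (A x))) - A (As (A (A x))))" .
  qed
  have "level (Suc (Suc (Suc 0))) (A (A (As (A (v 0)))) - A (As (A (A (v 0)))))"
    by (intro level_diff level_A level_As level_v0)
  then have lev: "level 3 (Z (As (v 0)) - As (Z (v 0)))"
    unfolding comm by (simp add: eval_nat_numeral)
  have "level 3 (Z (v 0))"
    unfolding level_def
  proof (intro allI impI)
    fix j assume j: "j \<le> d" "3 < j"
    \<comment> \<open>As \<open>v 0\<close> is an eigenvector of \<open>As\<close>, coordinate
      \<open>j\<close> of the commutator at \<open>v 0\<close> is
      \<open>\<theta> 0 - \<theta> j\<close> times that of \<open>Z (v 0)\<close>, so the bound on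
      the level passes to \<open>Z (v 0)\<close>.\<close>
    have "Z (As (v 0)) = \<theta> 0 *s Z (v 0)"
      by (simp add: As_v Z_def End_space_scale[OF diagonal_map_End_space[OF basis_u]])
    then have "(\<theta> 0 - \<theta> j) * cv j (Z (v 0)) = 0"
      using lev j by (simp add: level_def cv_simps cv_As algebra_simps)
    then show "cv j (Z (v 0)) = 0" using theta_neq[of 0 j] j by simp
  qed
  then obtain c where c: "\<And>i. i \<le> d \<Longrightarrow> cu i (Z (v 0)) = (\<Sum>j\<le>3. c j * \<theta> i ^ j) * cu i (v 0)"
    using level_polynomial[of 3 "Z (v 0)"] d3 by auto
  have z_cubic: "z i = c 0 + c 1 * \<theta> i + c 2 * (\<theta> i)\<^sup>2 + c 3 * \<theta> i ^ 3" if "i \<le> d" for i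
  proof -
    have "z i = (\<Sum>j\<le>3. c j * \<theta> i ^ j)"
      using c[OF that] cu_v0_nonzero[OF that] unfolding cu_Z[OF that] by simp
    then show ?thesis by (simp add: eval_nat_numeral)
  qed
  have rel: "x * y = c 1 + c 2 * (x + y) + c 3 * (x\<^sup>2 + x * y + y\<^sup>2)"
    if i: "i < d" and xy: "x = \<theta> i" "y = \<theta> (i + 1)" for i x y
  proof -
    have "z (i + 1) = c 0 + c 1 * y + c 2 * y\<^sup>2 + c 3 * y ^ 3" "z i = c 0 + c 1 * x + c 2 * x\<^sup>2 + c 3 * x ^ 3"
      using z_cubic[of i] z_cubic[of "i + 1"] i by (simp_all only: xy)
    moreover have "z (i + 1) = z i + x * y * (y - x)" unfolding xy by (rule z_Suc)
    ultimately have "(y - x) * (x * y - (c 1 + c 2 * (x + y) + c 3 * (x\<^sup>2 + x * y + y\<^sup>2))) = 0"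
      by algebra
    moreover have "y \<noteq> x" using theta_neq[of "i + 1" i] i xy by simp
    ultimately show ?thesis by simp
  qed
  \<comment> \<open>Otherwise consecutive instances of \<open>rel\<close> would force every interior
    \<open>\<theta> k\<close> to equal \<open>c 2\<close>, but 1 and 2 are distinct interior
    indices.\<close>
  have "c 3 \<noteq> 0"
  proof
    assume c3: "c 3 = 0"
    have "\<theta> k = c 2" if k: "k = i + 1" "k < d" for i k
    proof -
      define x y w where "x = \<theta> i" and "y = \<theta> k" and "w = \<theta> (k + 1)"
      have "x * y = c 1 + c 2 * (x + y)" "y * w = c 1 + c 2 * (y + w)"
        using rel[of i x y] rel[of k y w] k c3 by (simp_all add: x_def y_def w_def)
      then have "(x - w) * (y - c 2) = 0" by algebra
      moreover have "x \<noteq> w" using theta_neq[of i "k + 1"] k by (simp add: x_def w_def)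
      ultimately show ?thesis by (simp add: y_def)
    qed
    from this[of 1 0] this[of 2 1] have "\<theta> 1 = \<theta> 2" using d3 by simp
    then show False using theta_neq[of 1 2] d3 by simp
  qed
  have "(\<theta> i)\<^sup>2 - (1 / c 3 - 1) * \<theta> i * \<theta> (i + 1) + (\<theta> (i + 1))\<^sup>2 -
      (- c 2 / c 3) * (\<theta> i + \<theta> (i + 1)) - (- c 1 / c 3) = 0" if "i < d" for i
  proof -
    define x y where "x = \<theta> i" and "y = \<theta> (i + 1)"
    have "c 3 * (x\<^sup>2 - (1 / c 3 - 1) * x * y + y\<^sup>2 - (- c 2 / c 3) * (x + y) - (- c 1 / c 3)) =
        c 1 + c 2 * (x + y) + c 3 * (x\<^sup>2 + x * y + y\<^sup>2) - x * y"
      using \<open>c 3 \<noteq> 0\<close> by (simp add: field_simps)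
    then show ?thesis using rel[OF that x_def y_def] \<open>c 3 \<noteq> 0\<close> by (simp add: x_def y_def)
  qed
  then have "\<forall>i<d. (\<theta> i)\<^sup>2 - (1 / c 3 - 1) * \<theta> i * \<theta> (i + 1) + (\<theta> (i + 1))\<^sup>2 -
      (- c 2 / c 3) * (\<theta> i + \<theta> (i + 1)) - (- c 1 / c 3) = 0" by (intro allI impI)
  then show ?thesis by - (rule exI, rule exI, rule exI)
qed

lemma A_v0: "A (v 0) = a 0 *s v 0 + T 1 0 *s v 1"
proof (rule coord_eqI[OF basis_v])
  fix i assume i: "i \<le> d"
  consider "i = 0" | "i = 1" | "1 < i" by force
  then show "cv i (A (v 0)) = cv i (a 0 *s v 0 + T 1 0 *s v 1)"
    by cases (use i d3 T_zero[of i 0] diag_v[of 0] in \<open>simp_all add: cv_simps cv_A_v\<close>)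
qed

lemma A_v1: "A (v 1) = T 0 1 *s v 0 + a 1 *s v 1 + T 2 1 *s v 2"
proof (rule coord_eqI[OF basis_v])
  fix i assume i: "i \<le> d"
  consider "i = 0" | "i = 1" | "i = 2" | "2 < i" by force
  then show "cv i (A (v 1)) = cv i (T 0 1 *s v 0 + a 1 *s v 1 + T 2 1 *s v 2)"
    by cases (use i d3 T_zero[of i 1] diag_v[of 1] in \<open>simp_all add: cv_simps cv_A_v\<close>)
qed

text \<open>
  The Askey--Wilson relation applied to \<open>v 0\<close>. Its diagonal in \<open>u\<close> determines \<open>a\<close> away from the zeros
  of the quadratic polynomial on the left; its \<open>(0, 0)\<close> entry in \<open>v\<close> gives the inequation, which
  excludes the degenerate solutions of the bilinear relation.
\<close>

lemma askey_wilson: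
  assumes P: "\<And>i. i < d \<Longrightarrow> (\<theta> i)\<^sup>2 - \<beta> * \<theta> i * \<theta> (i + 1) + (\<theta> (i + 1))\<^sup>2 - \<gamma> * (\<theta> i + \<theta> (i + 1)) - \<rho> = 0"
  shows "\<exists>\<omega> \<eta>. (\<forall>i\<le>d. a i * ((2 - \<beta>) * (\<theta> i)\<^sup>2 - 2 * \<gamma> * \<theta> i - \<rho>) = \<gamma> * (\<theta> i)\<^sup>2 + \<omega> * \<theta> i + \<eta>) \<and>
    (2 - \<beta>) * \<theta> 0 * a 0 - \<gamma> * (\<theta> 0 + a 0) + \<rho> - \<omega> \<noteq> 0"
proof -
  \<comment> \<open>In the basis \<open>u\<close>, the operator applied to \<open>v 0\<close> here
    has entries \<open>Ts i j\<close> times the quadric at \<open>\<theta> i\<close>,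
    \<open>\<theta> j\<close>; the quadric kills the neighbouring entries and only the diagonal
    survives.\<close>
  define y where "y = A (A (As (v 0))) - \<beta> *s A (As (A (v 0))) + As (A (A (v 0)))
      - \<gamma> *s (A (As (v 0)) + As (A (v 0))) - \<rho> *s As (v 0)"
  have cu_y: "cu i y = a i * ((2 - \<beta>) * (\<theta> i)\<^sup>2 - 2 * \<gamma> * \<theta> i - \<rho>) * cu i (v 0)" if i: "i \<le> d" for i
  proof -
    let ?P = "\<lambda>j. (\<theta> i)\<^sup>2 - \<beta> * \<theta> i * \<theta> j + (\<theta> j)\<^sup>2 - \<gamma> * (\<theta> i + \<theta> j) - \<rho>"
    have "cu i y = (\<Sum>j\<le>d. Ts i j * ?P j * cu j (v 0))"
      unfolding y_def
      by (simp add: cu_simps cu_A[OF i] cu_As_A[of i "v 0"] cu_As_A_A[of i "v 0"] cu_As[of i "v 0"] sum_distrib_left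
          flip: sum_subtractf sum.distrib)
        (intro sum.cong refl, simp add: algebra_simps power2_eq_square)
    also have "\<dots> = Ts i i * ?P i * cu i (v 0)"
    proof (rule trans[OF sum.mono_neutral_right[of "{..d}" "{i}"]])
      show "\<forall>j\<in>{..d} - {i}. Ts i j * ?P j * cu j (v 0) = 0"
      proof
        fix j assume "j \<in> {..d} - {i}"
        then consider "j = i + 1" "i < d" | "i = j + 1" "j < d" | "Ts i j = 0"
          using Ts_zero[of i j] i by force
        then show "Ts i j * ?P j * cu j (v 0) = 0"
        proof cases
          case 1
          then have "?P j = 0" using P[of i] by simp
          then show ?thesis by simp
        next
          case 2
          then have "?P j = 0" using P[of j] by (simp add: algebra_simps)
          then show ?thesis by simp
        qed simp
      qed
    qed (use i in auto)
    also have "?P i = (2 - \<beta>) * (\<theta> i)\<^sup>2 - 2 * \<gamma> * \<theta> i - \<rho>" by algebra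
    finally show ?thesis using diag_u[OF i] by simp
  qed
  \<comment> \<open>Every word contains \<open>A\<close> at most twice and \<open>As\<close>
    preserves levels.\<close>
  have "level 2 y"
    unfolding y_def numeral_2_eq_2
    by (intro level_diff level_add level_scale level_mono[OF level_As[OF level_v0]]
        level_mono[OF level_A[OF level_As[OF level_v0]]] level_mono[OF level_As[OF level_A[OF level_v0]]]
        level_A level_As level_v0) simp_all
  then obtain n where n: "\<And>i. i \<le> d \<Longrightarrow> cu i y = (\<Sum>j\<le>2. n j * \<theta> i ^ j) * cu i (v 0)"
    using level_polynomial[of 2 y] d3 by auto
  have quad: "a i * ((2 - \<beta>) * (\<theta> i)\<^sup>2 - 2 * \<gamma> * \<theta> i - \<rho>) = n 2 * (\<theta> i)\<^sup>2 + n 1 * \<theta> i + n 0"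
    if "i \<le> d" for i
  proof -
    have "a i * ((2 - \<beta>) * (\<theta> i)\<^sup>2 - 2 * \<gamma> * \<theta> i - \<rho>) = (\<Sum>j\<le>2. n j * \<theta> i ^ j)"
      using n[OF that] cu_v0_nonzero[OF that] unfolding cu_y[OF that] by simp
    then show ?thesis by (simp add: eval_nat_numeral)
  qed
  have y: "y = n 2 *s A (A (v 0)) + n 1 *s A (v 0) + n 0 *s v 0"
  proof (rule coord_eqI[OF basis_u])
    fix i assume i: "i \<le> d"
    show "cu i y = cu i (n 2 *s A (A (v 0)) + n 1 *s A (v 0) + n 0 *s v 0)"
      unfolding cu_y[OF i] quad[OF i]
      by (simp add: cu_simps cu_A[OF i] power2_eq_square algebra_simps)
  qed
  define p q r where "p = v 0" and "q = v 1" and "r = v 2"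
  define x0 x1 x2 where "x0 = \<theta> 0" and "x1 = \<theta> 1" and "x2 = \<theta> 2"
  define b c b' where "b = T 1 0" and "c = T 0 1" and "b' = T 2 1"
  have Ap: "A p = a 0 *s p + b *s q" and Aq: "A q = c *s p + a 1 *s q + b' *s r"
    using A_v0 A_v1 by (simp_all only: p_def q_def r_def b_def c_def b'_def)
  have Asp: "As p = x0 *s p" "As q = x1 *s q" "As r = x2 *s r"
    using As_v d3 by (simp_all add: p_def q_def r_def x0_def x1_def x2_def)
  have cvp: "cv 0 p = 1" "cv 0 q = 0" "cv 0 r = 0" "cv 2 p = 0" "cv 2 q = 0" "cv 2 r = 1"
    using d3 by (simp_all add: p_def q_def r_def cv_simps)
  have nz: "b \<noteq> 0" "c \<noteq> 0" "b' \<noteq> 0"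
    using T_nonzero(1)[of 0] T_nonzero(2)[of 0] T_nonzero(2)[of 1] d3
    by (simp_all add: b_def c_def b'_def eval_nat_numeral)
  have neq: "x0 \<noteq> x2" using theta_neq[of 0 2] d3 by (simp add: x0_def x2_def)
  have P01: "x0\<^sup>2 - \<beta> * x0 * x1 + x1\<^sup>2 - \<gamma> * (x0 + x1) - \<rho> = 0"
    and P12: "x1\<^sup>2 - \<beta> * x1 * x2 + x2\<^sup>2 - \<gamma> * (x1 + x2) - \<rho> = 0"
    using P[of 0] P[of 1] d3 by (simp_all add: x0_def x1_def x2_def eval_nat_numeral)
  have "(x0 - x2) * (x0 + x2 - (\<beta> * x1 + \<gamma>)) = 0" using P01 P12 by algebra
  then have three: "x0 + x2 = \<beta> * x1 + \<gamma>" using neq by simp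
  note words = y[unfolded y_def p_def[symmetric]]
  note simps = Ap Aq Asp A_simps As_simps cv_simps(1-3) cvp
  \<comment> \<open>Coordinate 2 compares leading terms; the three-term recurrence then identifies
    \<open>n 2\<close> with \<open>\<gamma>\<close>.\<close>
  have "b * b' * (x0 + x2 - \<beta> * x1 - n 2) = 0"
    using arg_cong[OF words, of "cv 2"] by (simp add: simps algebra_simps)
  then have n2: "n 2 = \<gamma>" using nz three by (simp add: algebra_simps)
  have entry: "2 * x0 * ((a 0)\<^sup>2 + b * c) - \<beta> * ((a 0)\<^sup>2 * x0 + b * c * x1) - 2 * \<gamma> * x0 * a 0 - \<rho> * x0 =
      \<gamma> * ((a 0)\<^sup>2 + b * c) + n 1 * a 0 + n 0"
    using arg_cong[OF words, of "cv 0"] unfolding n2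
    by (simp add: simps algebra_simps power2_eq_square)
  have "(2 - \<beta>) * x0 * a 0 - \<gamma> * (x0 + a 0) + \<rho> - n 1 \<noteq> 0"
  proof
    assume Q: "(2 - \<beta>) * x0 * a 0 - \<gamma> * (x0 + a 0) + \<rho> - n 1 = 0"
    have "a 0 * ((2 - \<beta>) * x0\<^sup>2 - 2 * \<gamma> * x0 - \<rho>) = \<gamma> * x0\<^sup>2 + n 1 * x0 + n 0"
      using quad[of 0] n2 by (simp add: x0_def)
    \<comment> \<open>If the expression were zero, the \<open>(0, 0)\<close> entry in
      \<open>v\<close> and the formula for \<open>a 0\<close> would agree except for this
      off-diagonal contribution, which is nonzero.\<close>
    then have "b * c * (x0 - x2) = 0" using Q entry three by algebra
    then show False using nz neq by simp
  qed
  then have "(\<forall>i\<le>d. a i * ((2 - \<beta>) * (\<theta> i)\<^sup>2 - 2 * \<gamma> * \<theta> i - \<rho>) = \<gamma> * (\<theta> i)\<^sup>2 + n 1 * \<theta> i + n 0) \<and>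
    (2 - \<beta>) * \<theta> 0 * a 0 - \<gamma> * (\<theta> 0 + a 0) + \<rho> - n 1 \<noteq> 0"
    using quad n2 unfolding x0_def by auto
  then show ?thesis by - (rule exI, rule exI)
qed

subsection \<open>Boltzmann pairs\<close>

text \<open>\<open>X\<close> kills \<open>v 0\<close> and \<open>A (v 0)\<close>, which gives linear
  equations for each row of its matrix in \<open>u\<close>. Row 0 of its matrix in \<open>v\<close>
  also vanishes, which gives an equation for each column in \<open>u\<close>. Going down the rows,
  these equations remove the at most three possibly nonzero entries one at a time.\<close>

lemma bitridiagonal_zero:
  assumes X: "X \<in> End_space"
    and tri_u: "\<And>i j. i \<le> d \<Longrightarrow> j \<le> d \<Longrightarrow> i + 1 < j \<or> j + 1 < i \<Longrightarrow> cu i (X (u j)) = 0"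
    and tri_v: "\<And>i j. i \<le> d \<Longrightarrow> j \<le> d \<Longrightarrow> i + 1 < j \<or> j + 1 < i \<Longrightarrow> cv i (X (v j)) = 0"
    and v0: "X (v 0) = 0" and v1: "X (v 1) = 0"
  shows "X x = 0"
proof -
  \<comment> \<open>The free parameter \<open>t\<close> can be set to an eigenvalue in order to drop
    one chosen entry from the equation.\<close>
  have row: "(\<Sum>j\<le>d. cu i (X (u j)) * ((\<theta> j - t) * cu j (v 0))) = 0" if "i \<le> d" for i t
  proof -
    have "X (A (v 0) - t *s v 0) = 0"
      using v0 v1 by (simp add: A_v0 End_space_add[OF X] End_space_scale[OF X] End_space_diff[OF X])
    then have "(\<Sum>j\<le>d. cu i (X (u j)) * cu j (A (v 0) - t *s v 0)) = 0"
      unfolding coord_End_space[OF basis_u X, symmetric] by (simp add: cu_simps)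
    moreover have "(\<Sum>j\<le>d. cu i (X (u j)) * cu j (A (v 0) - t *s v 0)) =
        (\<Sum>j\<le>d. cu i (X (u j)) * ((\<theta> j - t) * cu j (v 0)))"
      by (intro sum.cong) (auto simp: cu_simps cu_A algebra_simps)
    ultimately show ?thesis by simp
  qed
  have cv0: "cv 0 (X y) = 0" for y
    unfolding coord_End_space[OF basis_v X, of 0 y]
  proof (intro sum.neutral ballI)
    fix j assume j: "j \<in> {..d}"
    consider "j = 0" | "j = 1" | "1 < j" by force
    then show "cv 0 (X (v j)) * cv j y = 0"
      by cases (use v0 v1 tri_v[of 0 j] j in \<open>simp_all add: cv_simps\<close>)
  qed
  have column: "(\<Sum>k\<le>d. cv 0 (u k) * cu k (X (u j))) = 0" for j
  proof -
    have "cv 0 (\<Sum>k\<le>d. cu k (X (u j)) *s u k) = 0"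
      using cv0[of "u j"] by (simp only: coord_expand[OF basis_u])
    then show ?thesis by (simp add: coord_sum[OF basis_v] cv_simps mult.commute)
  qed
  have zero: "\<forall>j\<le>d. cu i (X (u j)) = 0" if "i \<le> d" for i
    using that
  proof (induction i rule: less_induct)
    case (less i)
    note i = less.prems
    have left: "cu i (X (u j)) = 0" if j: "j < i" for j
    proof (cases "j + 1 = i")
      case False
      then show ?thesis using tri_u[of i j] i j by simp
    next
      case True
      \<comment> \<open>In column \<open>i - 1\<close>, the entries above row \<open>i\<close>
        vanish by induction and those below by tridiagonality.\<close>
      have "(\<Sum>k\<le>d. cv 0 (u k) * cu k (X (u j))) = cv 0 (u i) * cu i (X (u j))"
      proof (rule trans[OF sum.mono_neutral_right[of "{..d}" "{i}"]])
        show "\<forall>k\<in>{..d} - {i}. cv 0 (u k) * cu k (X (u j)) = 0"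
        proof
          fix k assume k: "k \<in> {..d} - {i}"
          have "cu k (X (u j)) = 0"
          proof (cases "k < i")
            case True
            then show ?thesis using less.IH[of k] i j by simp
          next
            case False
            then show ?thesis using tri_u[of k j] k i True by simp
          qed
          then show "cv 0 (u k) * cu k (X (u j)) = 0" by simp
        qed
      qed (use i in auto)
      then show ?thesis using column[of j] cv0_u_nonzero[OF i] by simp
    qed
    have diag: "cu i (X (u i)) = 0"
    proof -
      \<comment> \<open>This drops the right neighbour. In the last row there is none, and any
        eigenvalue other than \<open>\<theta> d\<close> serves.\<close>
      define t where "t = \<theta> (if i = d then 0 else i + 1)"
      have "t \<noteq> \<theta> i" using theta_neq[of "if i = d then 0 else i + 1" i] i d3 by (auto simp: t_def)
      have "(\<Sum>j\<le>d. cu i (X (u j)) * ((\<theta> j - t) * cu j (v 0))) = cu i (X (u i)) * ((\<theta> i - t) * cu i (v 0))"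
      proof (rule trans[OF sum.mono_neutral_right[of "{..d}" "{i}"]])
        show "\<forall>j\<in>{..d} - {i}. cu i (X (u j)) * ((\<theta> j - t) * cu j (v 0)) = 0"
        proof
          fix j assume j: "j \<in> {..d} - {i}"
          then consider "j < i" | "j = i + 1" | "i + 1 < j" by force
          then show "cu i (X (u j)) * ((\<theta> j - t) * cu j (v 0)) = 0"
          proof cases
            case 1
            then show ?thesis using left by simp
          next
            case 2
            then have "t = \<theta> j" using j by (auto simp: t_def)
            then show ?thesis by simp
          next
            case 3
            then show ?thesis using tri_u[of i j] i j by simp
          qed
        qed
      qed (use i in auto)
      then show ?thesis using row[OF i, of t] \<open>t \<noteq> \<theta> i\<close> cu_v0_nonzero[OF i] by simp
    qed
    have right: "cu i (X (u (i + 1))) = 0" if "i < d"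
    proof -
      have "(\<Sum>j\<le>d. cu i (X (u j)) * ((\<theta> j - \<theta> i) * cu j (v 0))) =
          cu i (X (u (i + 1))) * ((\<theta> (i + 1) - \<theta> i) * cu (i + 1) (v 0))"
      proof (rule trans[OF sum.mono_neutral_right[of "{..d}" "{i + 1}"]])
        show "\<forall>j\<in>{..d} - {i + 1}. cu i (X (u j)) * ((\<theta> j - \<theta> i) * cu j (v 0)) = 0"
        proof
          fix j assume j: "j \<in> {..d} - {i + 1}"
          then consider "j < i" | "j = i" | "i + 1 < j" by force
          then show "cu i (X (u j)) * ((\<theta> j - \<theta> i) * cu j (v 0)) = 0"
          proof cases
            case 1
            then show ?thesis using left by simp
          next
            case 3
            then show ?thesis using tri_u[of i j] i j by simp
          qed simp
        qed
      qed (use that in auto)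
      then show ?thesis
        using row[OF i, of "\<theta> i"] theta_neq[of "i + 1" i] cu_v0_nonzero[of "i + 1"] that by simp
    qed
    show ?case
    proof (intro allI impI)
      fix j assume j: "j \<le> d"
      consider "j < i" | "j = i" | "j = i + 1" | "i + 1 < j" by force
      then show "cu i (X (u j)) = 0"
        by cases (use left diag right tri_u[of i j] i j in auto)
    qed
  qed
  show ?thesis
  proof (rule coord_eqI[OF basis_u])
    fix i assume "i \<le> d"
    then show "cu i (X x) = cu i 0"
      unfolding coord_End_space[OF basis_u X, of i x] using zero[of i] by (simp add: cu_simps)
  qed
qed

definition combination :: "'a \<Rightarrow> 'a \<Rightarrow> 'a \<Rightarrow> 'a \<Rightarrow> 'a \<Rightarrow> 'b \<Rightarrow> 'b" where
  "combination e0 e1 e2 e3 e4 x = e0 *s x + e1 *s A x + e2 *s As x + e3 *s A (As x) + e4 *s As (A x)"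

lemma combination_End_space: "combination e0 e1 e2 e3 e4 \<in> End_space"
  by (rule End_spaceI) (simp_all add: combination_def A_simps As_simps scale_right_distrib mult.commute add_ac)

lemma cv_combination:
  assumes "i \<le> d" "j \<le> d"
  shows "cv i (combination e0 e1 e2 e3 e4 (v j)) =
    (if i = j then e0 + e2 * \<theta> j else 0) + (e1 + e3 * \<theta> j + e4 * \<theta> i) * T i j"
  using assms by (simp add: combination_def cv_simps As_v A_simps cv_As cv_A_v algebra_simps)

lemma cu_combination:
  assumes "i \<le> d" "j \<le> d"
  shows "cu i (combination e0 e1 e2 e3 e4 (u j)) =
    (if i = j then e0 + e1 * \<theta> j else 0) + (e2 + e3 * \<theta> i + e4 * \<theta> j) * Ts i j"
  using assms by (simp add: combination_def cu_simps A_u As_simps cu_A cu_As_u algebra_simps)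

text \<open>The images of \<open>v 0\<close> and \<open>v 1\<close> have two and three possibly
  nonzero coordinates, and the five coefficients can be fitted to these. The difference is then zero
  by \<open>bitridiagonal_zero\<close>.\<close>

lemma bitridiagonal_combination:
  assumes X: "X \<in> End_space"
    and tri_u: "\<And>i j. i \<le> d \<Longrightarrow> j \<le> d \<Longrightarrow> i + 1 < j \<or> j + 1 < i \<Longrightarrow> cu i (X (u j)) = 0"
    and tri_v: "\<And>i j. i \<le> d \<Longrightarrow> j \<le> d \<Longrightarrow> i + 1 < j \<or> j + 1 < i \<Longrightarrow> cv i (X (v j)) = 0"
  shows "\<exists>e0 e1 e2 e3 e4. X = combination e0 e1 e2 e3 e4"
proof -
  \<comment> \<open>The off-diagonal ratios \<open>p\<close>, \<open>q\<close>, \<open>r\<close>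
    determine \<open>e1\<close>, \<open>e3\<close>, \<open>e4\<close> by interpolation; the
    remaining diagonal parts \<open>s0\<close>, \<open>s1\<close> determine \<open>e0\<close> and
    \<open>e2\<close>.\<close>
  define p where "p = cv 1 (X (v 0)) / T 1 0"
  define q where "q = cv 0 (X (v 1)) / T 0 1"
  define r where "r = cv 2 (X (v 1)) / T 2 1"
  define e4 where "e4 = (r - q) / (\<theta> 2 - \<theta> 0)"
  define e3 where "e3 = e4 + (q - p) / (\<theta> 1 - \<theta> 0)"
  define e1 where "e1 = p - e3 * \<theta> 0 - e4 * \<theta> 1"
  define s0 where "s0 = cv 0 (X (v 0)) - (e1 + e3 * \<theta> 0 + e4 * \<theta> 0) * a 0"
  define s1 where "s1 = cv 1 (X (v 1)) - (e1 + e3 * \<theta> 1 + e4 * \<theta> 1) * a 1"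
  define e2 where "e2 = (s1 - s0) / (\<theta> 1 - \<theta> 0)"
  define e0 where "e0 = s0 - e2 * \<theta> 0"
  let ?G = "combination e0 e1 e2 e3 e4"
  have nz: "T 1 0 \<noteq> 0" "T 0 1 \<noteq> 0" "T 2 1 \<noteq> 0"
    using T_nonzero(1)[of 0] T_nonzero(2)[of 0] T_nonzero(2)[of 1] d3 by (simp_all add: eval_nat_numeral)
  have neq: "\<theta> 2 - \<theta> 0 \<noteq> 0" "\<theta> 1 - \<theta> 0 \<noteq> 0" using theta_neq[of 2 0] theta_neq[of 1 0] d3 by simp_all
  have m: "e4 * (\<theta> 2 - \<theta> 0) = r - q" "(e3 - e4) * (\<theta> 1 - \<theta> 0) = q - p" "e2 * (\<theta> 1 - \<theta> 0) = s1 - s0"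
    using neq by (simp_all add: e4_def e3_def e2_def)
  have p: "e1 + e3 * \<theta> 0 + e4 * \<theta> 1 = p" by (simp add: e1_def)
  have q: "e1 + e3 * \<theta> 1 + e4 * \<theta> 0 = q"
  proof -
    have "q = p + (e3 - e4) * (\<theta> 1 - \<theta> 0)" using m(2) by simp
    then show ?thesis unfolding p[symmetric] by (simp add: algebra_simps)
  qed
  have r: "e1 + e3 * \<theta> 1 + e4 * \<theta> 2 = r"
  proof -
    have "r = q + e4 * (\<theta> 2 - \<theta> 0)" using m(1) by simp
    then show ?thesis unfolding q[symmetric] by (simp add: algebra_simps)
  qed
  have s0: "e0 + e2 * \<theta> 0 = s0" by (simp add: e0_def)
  have s1: "e0 + e2 * \<theta> 1 = s1"
  proof -
    have "s1 = s0 + e2 * (\<theta> 1 - \<theta> 0)" using m(3) by simp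
    then show ?thesis unfolding s0[symmetric] by (simp add: algebra_simps)
  qed
  have G0: "?G (v 0) = X (v 0)"
  proof (rule coord_eqI[OF basis_v])
    fix i assume i: "i \<le> d"
    consider "i = 0" | "i = 1" | "1 < i" by force
    then show "cv i (?G (v 0)) = cv i (X (v 0))"
    proof cases
      case 1
      then show ?thesis using cv_combination[of 0 0 e0 e1 e2 e3 e4] diag_v[of 0] s0 by (simp add: s0_def)
    next
      case 2
      then show ?thesis using cv_combination[of 1 0 e0 e1 e2 e3 e4] p nz d3 by (simp add: p_def)
    next
      case 3
      then show ?thesis using cv_combination[of i 0 e0 e1 e2 e3 e4] T_zero[of i 0] tri_v[of i 0] i by simp
    qed
  qed
  have G1: "?G (v 1) = X (v 1)"
  proof (rule coord_eqI[OF basis_v])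
    fix i assume i: "i \<le> d"
    consider "i = 0" | "i = 1" | "i = 2" | "2 < i" by force
    then show "cv i (?G (v 1)) = cv i (X (v 1))"
    proof cases
      case 1
      then show ?thesis using cv_combination[of 0 1 e0 e1 e2 e3 e4] q nz d3 by (simp add: q_def)
    next
      case 2
      then show ?thesis using cv_combination[of 1 1 e0 e1 e2 e3 e4] diag_v[of 1] s1 d3 by (simp add: s1_def)
    next
      case 3
      then show ?thesis using cv_combination[of 2 1 e0 e1 e2 e3 e4] r nz d3 by (simp add: r_def)
    next
      case 4
      then show ?thesis using cv_combination[of i 1 e0 e1 e2 e3 e4] T_zero[of i 1] tri_v[of i 1] i by simp
    qed
  qed
  have "X x - ?G x = 0" for x
  proof (rule bitridiagonal_zero[where X = "\<lambda>x. X x - ?G x"])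
    show "(\<lambda>x. X x - ?G x) \<in> End_space"
      by (rule End_spaceI) (simp_all add: End_space_add[OF X] End_space_scale[OF X]
        End_space_add[OF combination_End_space] End_space_scale[OF combination_End_space] scale_right_diff_distrib)
    show "cu i (X (u j) - ?G (u j)) = 0" if "i \<le> d" "j \<le> d" "i + 1 < j \<or> j + 1 < i" for i j
      using tri_u[OF that] Ts_zero[OF that] that(3) by (auto simp: cu_simps cu_combination[OF that(1,2)])
    show "cv i (X (v j) - ?G (v j)) = 0" if "i \<le> d" "j \<le> d" "i + 1 < j \<or> j + 1 < i" for i j
      using tri_v[OF that] T_zero[OF that] that(3) by (auto simp: cv_simps cv_combination[OF that(1,2)])
  qed (simp_all only: G0 G1 diff_self)
  then have "X = ?G" by (intro ext) (simp only: right_minus_eq)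
  then show ?thesis by - (rule exI, rule exI, rule exI, rule exI, rule exI)
qed

section \<open>Necessity of the bilinear relation and construction of spin pairs\<close>

text \<open>\<open>W\<close> is diagonal in \<open>u\<close> and \<open>Ws\<close> in
  \<open>v\<close>, so the common conjugate \<open>X\<close> is tridiagonal in both bases and keeps
  the diagonal \<open>a\<close>. Writing \<open>X\<close> as a combination expresses this diagonal
  in two ways.\<close>

lemma spin_imp_bilinear_relation:
  assumes "has_spin A As"
  shows "\<exists>f0 f1 f2 f3. \<not> (f0 = 0 \<and> f1 = 0 \<and> f2 = 0 \<and> f3 = 0) \<and>
    (\<forall>i\<le>d. f0 + f1 * \<theta> i + f2 * a i + f3 * a i * \<theta> i = 0)"
proof -
  obtain W Ws where W: "W \<in> End_space" "bij W" "W \<circ> A = A \<circ> W"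
    and Ws: "Ws \<in> End_space" "bij Ws" "Ws \<circ> As = As \<circ> Ws"
    and eq: "W \<circ> As \<circ> inv W = inv Ws \<circ> A \<circ> Ws"
    using assms unfolding has_spin_def by blast
  obtain t where t: "\<And>j. j \<le> d \<Longrightarrow> t j \<noteq> 0" "\<And>j. j \<le> d \<Longrightarrow> W (u j) = t j *s u j"
    "\<And>j. j \<le> d \<Longrightarrow> inv W (u j) = (1 / t j) *s u j"
    using commuting_bij_eigenvectors[OF basis_u W(1,2) A A_u inj W(3)] by blast
  obtain s where s: "\<And>j. j \<le> d \<Longrightarrow> s j \<noteq> 0" "\<And>j. j \<le> d \<Longrightarrow> Ws (v j) = s j *s v j"
    "\<And>j. j \<le> d \<Longrightarrow> inv Ws (v j) = (1 / s j) *s v j"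
    using commuting_bij_eigenvectors[OF basis_v Ws(1,2) As As_v inj Ws(3)] by blast
  define X where "X = W \<circ> As \<circ> inv W"
  have X': "X = inv Ws \<circ> A \<circ> Ws" using eq by (simp add: X_def)
  have X: "X \<in> End_space"
    by (rule End_spaceI)
      (simp_all add: X_def End_space_add[OF W(1)] End_space_scale[OF W(1)] As_simps
        End_space_add[OF End_space_inv[OF W(1,2)]] End_space_scale[OF End_space_inv[OF W(1,2)]])
  have cu_X: "cu i (X (u j)) = t i / t j * Ts i j" if "i \<le> d" "j \<le> d" for i j
    using that by (simp add: X_def t(3) As_simps cu_simps End_space_scale[OF W(1)] cu_As_u
        coord_eigenvectors[OF basis_u W(1) t(2)])
  have cv_X: "cv i (X (v j)) = s j / s i * T i j" if "i \<le> d" "j \<le> d" for i j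
    using that by (simp add: X' s(2) A_simps cv_simps cv_A_v End_space_scale[OF End_space_inv[OF Ws(1,2)]]
        coord_eigenvectors[OF basis_v End_space_inv[OF Ws(1,2)] s(3)])
  obtain e0 e1 e2 e3 e4 where comb: "X = combination e0 e1 e2 e3 e4"
    using bitridiagonal_combination[OF X] by (force simp: cu_X cv_X T_zero Ts_zero)
  have a_u: "a i = e0 + e1 * \<theta> i + (e2 + e3 * \<theta> i + e4 * \<theta> i) * a i" if "i \<le> d" for i
    using cu_combination[OF that that, of e0 e1 e2 e3 e4] cu_X[OF that that] t(1)[OF that]
    unfolding comb[symmetric] by (simp add: diag_u[OF that])
  have a_v: "a i = e0 + e2 * \<theta> i + (e1 + e3 * \<theta> i + e4 * \<theta> i) * a i" if "i \<le> d" for i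
    using cv_combination[OF that that, of e0 e1 e2 e3 e4] cv_X[OF that that] s(1)[OF that]
    unfolding comb[symmetric] by (simp add: diag_v[OF that])
  show ?thesis
  proof (cases "e0 = 0 \<and> e2 = 0 \<and> e1 - 1 = 0 \<and> e3 + e4 = 0")
    case False
    have "e0 + e2 * \<theta> i + (e1 - 1) * a i + (e3 + e4) * a i * \<theta> i = 0" if "i \<le> d" for i
      using a_v[OF that] by algebra
    then show ?thesis using False
      by - (rule exI[of _ e0], rule exI[of _ e2], rule exI[of _ "e1 - 1"], rule exI[of _ "e3 + e4"], rule conjI,
        assumption, intro allI impI)
  next
    \<comment> \<open>The relation from \<open>v\<close> is trivial here, but the one from
      \<open>u\<close> reduces to \<open>a i = \<theta> i\<close>.\<close>
    case True
    then have e: "e0 = 0" "e2 = 0" "e1 = 1" "e3 + e4 = 0" by simp_all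
    have "0 + 1 * \<theta> i + (- 1) * a i + 0 * a i * \<theta> i = 0" if "i \<le> d" for i
      using a_u[OF that] e by algebra
    moreover have "\<not> ((0::'a) = 0 \<and> (1::'a) = 0 \<and> (- 1::'a) = 0 \<and> (0::'a) = 0)" by simp
    ultimately show ?thesis
      by - (rule exI[of _ 0], rule exI[of _ 1], rule exI[of _ "- 1"], rule exI[of _ 0], rule conjI,
        assumption, intro allI impI)
  qed
qed

text \<open>The factors relating \<open>B\<close> to \<open>As\<close> in \<open>u\<close> and to
  \<open>A\<close> in \<open>v\<close> are transposes of each other. Hence one sequence
  \<open>t\<close> defines both \<open>W\<close> and \<open>Ws\<close>.\<close>

lemma spin_parameters_imp_spin:
  assumes "spin_parameters d \<theta> a"
  shows "has_spin A As"
proof -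
  obtain e0 e1 e2 e3 where
    e: "\<And>i. i < d \<Longrightarrow> (e1 + e2 * \<theta> (i + 1) + e3 * \<theta> i) * (e1 + e2 * \<theta> i + e3 * \<theta> (i + 1)) = 1"
    and M: "\<And>i. i \<le> d \<Longrightarrow> e0 + (e1 - 1) * a i + e1 * \<theta> i + (e2 + e3) * a i * \<theta> i = 0"
    using assms unfolding spin_parameters_def by blast
  \<comment> \<open>Successive quotients of \<open>t\<close> are the subdiagonal factors of
    \<open>B\<close> in \<open>u\<close>; the reciprocal condition makes the superdiagonal ones
    match as well.\<close>
  define t where "t i = (\<Prod>k<i. e1 + e2 * \<theta> (k + 1) + e3 * \<theta> k)" for i
  have t_Suc: "t (i + 1) = t i * (e1 + e2 * \<theta> (i + 1) + e3 * \<theta> i)" for i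
    by (simp add: t_def)
  have t_nz: "t i \<noteq> 0" if "i \<le> d" for i
  proof -
    have "e1 + e2 * \<theta> (k + 1) + e3 * \<theta> k \<noteq> 0" if "k < i" for k
      using e[of k] that \<open>i \<le> d\<close> by auto
    then show ?thesis by (auto simp: t_def)
  qed
  have ratio: "t i * M' = t j * ((e1 + e2 * \<theta> i + e3 * \<theta> j) * M')"
    if "i = j + 1 \<and> j < d \<or> j = i + 1 \<and> i < d" for i j M'
    using that
  proof
    assume "i = j + 1 \<and> j < d"
    then show ?thesis by (simp add: t_Suc[simplified])
  next
    assume j: "j = i + 1 \<and> i < d"
    have "t j * ((e1 + e2 * \<theta> i + e3 * \<theta> j) * M') =
        t i * M' * ((e1 + e2 * \<theta> (i + 1) + e3 * \<theta> i) * (e1 + e2 * \<theta> i + e3 * \<theta> (i + 1)))"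
      using j t_Suc[of i] by (simp add: mult_ac)
    also have "\<dots> = t i * M'" using j by (simp only: e) simp
    finally show ?thesis by (rule sym)
  qed
  let ?B = "combination e0 e1 e1 e2 e3"
  let ?W = "diagonal_map d u t"
  let ?Ws = "diagonal_map d v t"
  have cases: "i = j \<or> (i = j + 1 \<and> j < d \<or> j = i + 1 \<and> i < d) \<or> (i + 1 < j \<or> j + 1 < i)"
    if "i \<le> d" "j \<le> d" for i j :: nat using that by force
  have diag: "t i * a i = t i * (e0 + e1 * \<theta> i + (e1 + e2 * \<theta> i + e3 * \<theta> i) * a i)" if "i \<le> d" for i
    using M[OF that] by algebra
  have W: "?W \<in> End_space" "bij ?W" and Ws: "?Ws \<in> End_space" "bij ?Ws"
    using diagonal_map_End_space[OF basis_u] diagonal_map_End_space[OF basis_v]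
      bij_diagonal_map[OF basis_u, of t] bij_diagonal_map[OF basis_v, of t] t_nz by auto
  have WA: "?W \<circ> As = ?B \<circ> ?W"
  proof (rule End_space_eqI[OF basis_u End_space_comp[OF W(1) As] End_space_comp[OF combination_End_space W(1)]])
    fix j assume j: "j \<le> d"
    show "(?W \<circ> As) (u j) = (?B \<circ> ?W) (u j)"
    proof (rule coord_eqI[OF basis_u])
      fix i assume i: "i \<le> d"
      have "t i * Ts i j = t j * ((if i = j then e0 + e1 * \<theta> j else 0) + (e1 + e2 * \<theta> i + e3 * \<theta> j) * Ts i j)"
        using cases[OF i j]
      proof (elim disjE)
        assume "i = j"
        then show ?thesis using diag[OF i] diag_u[OF i] by simp
      qed (use ratio[of i j "Ts i j"] Ts_zero[OF i j] in auto)
      then show "cu i ((?W \<circ> As) (u j)) = cu i ((?B \<circ> ?W) (u j))"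
        by (simp add: coord_diagonal_map[OF basis_u i] diagonal_map_basis[OF basis_u j]
            End_space_scale[OF combination_End_space] cu_simps cu_combination[OF i j] cu_As_u)
    qed
  qed
  have AW: "A \<circ> ?Ws = ?Ws \<circ> ?B"
  proof (rule End_space_eqI[OF basis_v End_space_comp[OF A Ws(1)] End_space_comp[OF Ws(1) combination_End_space]])
    fix j assume j: "j \<le> d"
    show "(A \<circ> ?Ws) (v j) = (?Ws \<circ> ?B) (v j)"
    proof (rule coord_eqI[OF basis_v])
      fix i assume i: "i \<le> d"
      have "t j * T i j = t i * ((if i = j then e0 + e1 * \<theta> j else 0) + (e1 + e2 * \<theta> j + e3 * \<theta> i) * T i j)"
        using cases[OF i j]
      proof (elim disjE)
        assume "i = j"
        then show ?thesis using diag[OF i] diag_v[OF i] by simp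
      qed (use ratio[of j i "T i j"] T_zero[OF i j] in auto)
      then show "cv i ((A \<circ> ?Ws) (v j)) = cv i ((?Ws \<circ> ?B) (v j))"
        by (simp add: coord_diagonal_map[OF basis_v i] diagonal_map_basis[OF basis_v j]
            A_simps cv_simps cv_combination[OF i j] cv_A_v)
    qed
  qed
  have "?W \<circ> A = A \<circ> ?W"
    by (rule End_space_eqI[OF basis_u End_space_comp[OF W(1) A] End_space_comp[OF A W(1)]])
      (simp add: A_u diagonal_map_basis[OF basis_u] A_simps End_space_scale[OF W(1)] mult.commute)
  moreover have "?Ws \<circ> As = As \<circ> ?Ws"
    by (rule End_space_eqI[OF basis_v End_space_comp[OF Ws(1) As] End_space_comp[OF As Ws(1)]])
      (simp add: As_v diagonal_map_basis[OF basis_v] As_simps End_space_scale[OF Ws(1)] mult.commute)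
  moreover have "?W \<circ> As \<circ> inv ?W = ?B"
    unfolding WA using surj_iff[THEN iffD1, OF bij_is_surj[OF W(2)]] by (simp add: comp_assoc)
  moreover have "inv ?Ws \<circ> A \<circ> ?Ws = ?B"
    unfolding comp_assoc AW using inj_iff[THEN iffD1, OF bij_is_inj[OF Ws(2)]]
    by (simp flip: comp_assoc)
  ultimately show ?thesis unfolding has_spin_def using W Ws by metis
qed

end

section \<open>Passage from a self-dual Leonard system to eigenbases\<close>

context endo_space
begin

lemma primitive_idempotent_basis:
  assumes w: "ordered_basis d w" and E: "\<And>i. i \<le> d \<Longrightarrow> primitive_idempotent D (\<theta> i) (E i)"
    and inj: "inj_on \<theta> {..d}" and eig: "\<And>i. i \<le> d \<Longrightarrow> w i \<in> eigenspace D (\<theta> i)"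
    and ij: "i \<le> d" "j \<le> d"
  shows "E i (w j) = (if i = j then w j else 0)"
proof (cases "i = j")
  case True
  then show ?thesis using E[OF ij(1)] eig[OF ij(2)] by (simp add: primitive_idempotent_def)
next
  case False
  then have "\<theta> j \<noteq> \<theta> i" using inj_onD[OF inj, of j i] ij by auto
  moreover have "eigenvalue D (\<theta> j)" using E[OF ij(2)] by (simp add: primitive_idempotent_def)
  ultimately have "w j \<in> span (\<Union>\<mu>\<in>{\<mu>. eigenvalue D \<mu> \<and> \<mu> \<noteq> \<theta> i}. eigenspace D \<mu>)"
    using eig[OF ij(2)] by (intro span_base) auto
  then show ?thesis using E[OF ij(1)] False by (simp add: primitive_idempotent_def)
qed

text \<open>The isomorphism carries the equation \<open>A \<circ> E i = \<theta> i E i\<close> to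
  its analogue for \<open>As\<close> and \<open>Es i\<close>, so the eigenvalue sequences agree. It
  carries the compression of \<open>A\<close> by \<open>Es i\<close>, which is \<open>a i\<close>
  times \<open>Es i\<close>, to that of \<open>As\<close> by \<open>E i\<close>, so the diagonals
  agree.\<close>

lemma self_dual_leonard_system_frame:
  assumes d: "d \<ge> 3" and sys: "leonard_system d A E As Es" and dual: "self_dual d A E As Es"
    and \<theta>s: "dual_eigenvalue_sequence d As Es \<theta>s"
    and a: "\<forall>i\<le>d. a i = trace_map (Es i \<circ> A)"
  shows "\<exists>u v. self_dual_frame scale d A As u v \<theta>s a"
proof -
  have A: "A \<in> End_space" and As: "As \<in> End_space"
    using sys by (auto simp: leonard_system_def leonard_pair_def)
  obtain \<theta> u where \<theta>: "inj_on \<theta> {..d}" and E: "\<And>i. i \<le> d \<Longrightarrow> primitive_idempotent A (\<theta> i) (E i)"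
    and u: "\<And>i. i \<le> d \<Longrightarrow> u i \<in> eigenspace A (\<theta> i)" and leonard_u: "leonard_basis d As A u"
    using sys by (auto simp: leonard_system_def standard_ordering_def bij_betw_def)
  obtain \<theta>' v where \<theta>': "inj_on \<theta>' {..d}" and Es: "\<And>i. i \<le> d \<Longrightarrow> primitive_idempotent As (\<theta>' i) (Es i)"
    and v: "\<And>i. i \<le> d \<Longrightarrow> v i \<in> eigenspace As (\<theta>' i)" and leonard_v: "leonard_basis d A As v"
    using sys by (auto simp: leonard_system_def standard_ordering_def bij_betw_def)
  have bu: "ordered_basis d u" and bv: "ordered_basis d v"
    using leonard_u leonard_v by (auto simp: leonard_basis_def)
  have E_End: "E i \<in> End_space" and Es_End: "Es i \<in> End_space" if "i \<le> d" for i
    using E[OF that] Es[OF that] by (auto simp: primitive_idempotent_def)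
  have A_u: "A (u i) = \<theta> i *s u i" and As_v: "As (v i) = \<theta>' i *s v i" if "i \<le> d" for i
    using u[OF that] v[OF that] by (auto simp: eigenspace_def)
  have E_u: "E i (u j) = (if i = j then u j else 0)" if "i \<le> d" "j \<le> d" for i j
    by (rule primitive_idempotent_basis[OF bu _ \<theta> _ that]) (fact E u)+
  have Es_v: "Es i (v j) = (if i = j then v j else 0)" if "i \<le> d" "j \<le> d" for i j
    by (rule primitive_idempotent_basis[OF bv _ \<theta>' _ that]) (fact Es v)+
  have scale_End: "(\<lambda>x. c *s F x) \<in> End_space" if "F \<in> End_space" for c F
    by (rule End_spaceI) (simp_all add: End_space_add[OF that] End_space_scale[OF that]
        scale_right_distrib mult.commute)
  have scalars: "x = y" if "x *s w j = y *s w j" "ordered_basis d w" "j \<le> d" for x y w j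
    using that basis_nonzero by (simp add: scale_cancel_right)
  have \<theta>s_eq: "\<theta>s i = \<theta>' i" if i: "i \<le> d" for i
  proof -
    have "(As \<circ> Es i) (v i) = \<theta>s i *s Es i (v i)"
      using \<theta>s i by (simp add: dual_eigenvalue_sequence_def)
    then have "\<theta>' i *s v i = \<theta>s i *s v i" by (simp add: Es_v[OF i i] As_v[OF i])
    then show ?thesis using scalars[of "\<theta>' i" v i "\<theta>s i"] bv i by simp
  qed
  have Es_coord: "Es i x = coord d v i x *s v i" if i: "i \<le> d" for i x
  proof -
    have "Es i x = (\<Sum>j\<le>d. coord d v j x *s Es i (v j))"
      by (rule End_space_expand[OF bv Es_End[OF i]])
    also have "\<dots> = (\<Sum>j\<le>d. if i = j then coord d v j x *s v j else 0)"
      by (intro sum.cong) (auto simp: Es_v[OF i])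
    finally show ?thesis using i by simp
  qed
  \<comment> \<open>\<open>Es i\<close> projects onto the line of \<open>v i\<close>, so the trace
    reduces to one diagonal entry of \<open>A\<close> in \<open>v\<close>.\<close>
  have a_eq: "a i = coord d v i (A (v i))" if i: "i \<le> d" for i
  proof -
    have "a i = (\<Sum>j\<le>d. coord d v j ((Es i \<circ> A) (v j)))"
      using a i trace_map_eq_sum[OF bv End_space_comp[OF Es_End[OF i] A]] by simp
    also have "\<dots> = (\<Sum>j\<le>d. if i = j then coord d v i (A (v j)) else 0)"
      using i by (intro sum.cong) (auto simp: Es_coord[OF i] coord_scale[OF bv] coord_basis[OF bv])
    finally show ?thesis using i by simp
  qed
  obtain \<sigma> where iso: "End_algebra_iso \<sigma>" and \<sigma>A: "\<sigma> A = As" and \<sigma>As: "\<sigma> As = A"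
    and \<sigma>E: "\<And>i. i \<le> d \<Longrightarrow> \<sigma> (E i) = Es i" and \<sigma>Es: "\<And>i. i \<le> d \<Longrightarrow> \<sigma> (Es i) = E i"
    using dual unfolding self_dual_def leonard_system_isomorphic_def by blast
  have \<sigma>_scale: "\<sigma> (\<lambda>x. c *s F x) = (\<lambda>x. c *s \<sigma> F x)" if "F \<in> End_space" for c F
    using iso that unfolding End_algebra_iso_def by blast
  have \<sigma>_comp: "\<sigma> (F \<circ> G) = \<sigma> F \<circ> \<sigma> G" if "F \<in> End_space" "G \<in> End_space" for F G
    using iso that unfolding End_algebra_iso_def by blast
  have \<theta>_eq: "\<theta> i = \<theta>s i" if i: "i \<le> d" for i
  proof -
    have "A \<circ> E i = (\<lambda>x. \<theta> i *s E i x)"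
    proof (rule End_space_eqI[OF bu End_space_comp[OF A E_End[OF i]] scale_End[OF E_End[OF i]]])
      fix j assume "j \<le> d"
      then show "(A \<circ> E i) (u j) = \<theta> i *s E i (u j)"
        using E_u[OF i] A_u by (simp add: End_space_zero[OF A])
    qed
    then have "\<sigma> (A \<circ> E i) = \<sigma> (\<lambda>x. \<theta> i *s E i x)" by (rule arg_cong)
    then have "As \<circ> Es i = (\<lambda>x. \<theta> i *s Es i x)"
      using A E_End[OF i] by (simp add: \<sigma>_comp \<sigma>_scale \<sigma>A \<sigma>E[OF i])
    then have "As (Es i (v i)) = \<theta> i *s Es i (v i)" by (metis comp_apply)
    then have "\<theta>' i *s v i = \<theta> i *s v i" by (simp add: Es_v[OF i i] As_v[OF i])
    then show ?thesis using scalars[of "\<theta>' i" v i "\<theta> i"] bv i \<theta>s_eq[OF i] by simp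
  qed
  have diag_u: "coord d u i (As (u i)) = a i" if i: "i \<le> d" for i
  proof -
    have "Es i \<circ> (A \<circ> Es i) = (\<lambda>x. a i *s Es i x)"
      using i by (auto simp: fun_eq_iff Es_coord[OF i] a_eq[OF i] End_space_scale[OF A] coord_scale[OF bv] mult.commute)
    then have "\<sigma> (Es i \<circ> (A \<circ> Es i)) = \<sigma> (\<lambda>x. a i *s Es i x)" by (rule arg_cong)
    then have "E i \<circ> (As \<circ> E i) = (\<lambda>x. a i *s E i x)"
      using A Es_End[OF i] End_space_comp[OF A Es_End[OF i]] by (simp add: \<sigma>_comp \<sigma>_scale \<sigma>A \<sigma>Es[OF i])
    then have "E i (As (E i (u i))) = a i *s E i (u i)" by (metis comp_apply)
    then have *: "E i (As (u i)) = a i *s u i" by (simp add: E_u[OF i i])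
    have "E i (As (u i)) = (\<Sum>j\<le>d. coord d u j (As (u i)) *s E i (u j))"
      by (rule End_space_expand[OF bu E_End[OF i]])
    also have "\<dots> = (\<Sum>j\<le>d. if i = j then coord d u j (As (u i)) *s u j else 0)"
      by (intro sum.cong) (auto simp: E_u[OF i])
    also have "\<dots> = coord d u i (As (u i)) *s u i" using i by simp
    finally have "coord d u i (As (u i)) *s u i = a i *s u i" unfolding * by (rule sym)
    then show ?thesis using scalars[of _ u i] bu i by blast
  qed
  have "self_dual_frame scale d A As u v \<theta>s a"
  proof unfold_locales
    show "inj_on \<theta>s {..d}" using \<theta>' \<theta>s_eq by (simp add: inj_on_def)
    show "A (u i) = \<theta>s i *s u i" "As (v i) = \<theta>s i *s v i" if "i \<le> d" for i
      using A_u[OF that] As_v[OF that] \<theta>_eq[OF that] \<theta>s_eq[OF that] by simp_all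
    show "matrix_entry d v A i i = a i" "matrix_entry d u As i i = a i" if "i \<le> d" for i
      using a_eq[OF that] diag_u[OF that] by (simp_all add: matrix_entry_def coord_def)
  qed (fact d A As leonard_u leonard_v)+
  then show ?thesis by blast
qed

end

theorem corollary14p6:
  fixes scale :: "'a::alg_closed_field \<Rightarrow> 'v::ab_group_add \<Rightarrow> 'v"
    and d :: nat
    and A As :: "'v \<Rightarrow> 'v"
    and E Es :: "nat \<Rightarrow> 'v \<Rightarrow> 'v"
    and \<theta>s a :: "nat \<Rightarrow> 'a"
  assumes "vector_space scale"
    and "vector_space.dim scale (UNIV :: 'v set) = d + 1"
    and "d \<ge> 3"
    and "endo_space.leonard_system scale d A E As Es"
    and "endo_space.self_dual scale d A E As Es"
    and "endo_space.dual_eigenvalue_sequence scale d As Es \<theta>s"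
    and "\<forall>i\<le>d. a i = endo_space.trace_map scale (Es i \<circ> A)"
  shows "(endo_space.has_spin scale A As \<longleftrightarrow>
            (\<exists>f0 f1 f2 f3 :: 'a. \<not> (f0 = 0 \<and> f1 = 0 \<and> f2 = 0 \<and> f3 = 0) \<and>
               (\<forall>i\<le>d. f0 + f1 * \<theta>s i + f2 * a i + f3 * a i * \<theta>s i = 0))) \<and>
         (endo_space.has_spin scale A As \<longleftrightarrow>
            (\<forall>i\<le>d. \<forall>j\<le>d.
               (a i - a 0) * (\<theta>s i - \<theta>s d) * (a j - a d) * (\<theta>s j - \<theta>s 0) =
               (a i - a d) * (\<theta>s i - \<theta>s 0) * (a j - a 0) * (\<theta>s j - \<theta>s d)))"
proof -
  interpret endo_space scale using assms(1) by (rule endo_space.intro)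
  obtain u v where "self_dual_frame scale d A As u v \<theta>s a"
    using self_dual_leonard_system_frame[OF assms(3-7)] by blast
  then interpret self_dual_frame scale d A As u v \<theta>s a .
  have spin: "has_spin A As \<longleftrightarrow> (\<exists>f0 f1 f2 f3. \<not> (f0 = 0 \<and> f1 = 0 \<and> f2 = 0 \<and> f3 = 0) \<and>
      (\<forall>i\<le>d. f0 + f1 * \<theta>s i + f2 * a i + f3 * a i * \<theta>s i = 0))" (is "_ \<longleftrightarrow> ?R")
  proof
    assume ?R
    then obtain f0 f1 f2 f3 where nz: "\<not> (f0 = 0 \<and> f1 = 0 \<and> f2 = 0 \<and> f3 = 0)"
      and L: "\<And>i. i \<le> d \<Longrightarrow> f0 + f1 * \<theta>s i + f2 * a i + f3 * a i * \<theta>s i = 0" by blast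
    obtain \<beta> \<gamma> \<rho> where P: "\<And>i. i < d \<Longrightarrow> (\<theta>s i)\<^sup>2 - \<beta> * \<theta>s i * \<theta>s (i + 1) + (\<theta>s (i + 1))\<^sup>2
        - \<gamma> * (\<theta>s i + \<theta>s (i + 1)) - \<rho> = 0"
      using eigenvalue_quadric by blast
    obtain \<omega> \<eta> where
      N: "\<And>i. i \<le> d \<Longrightarrow> a i * ((2 - \<beta>) * (\<theta>s i)\<^sup>2 - 2 * \<gamma> * \<theta>s i - \<rho>) = \<gamma> * (\<theta>s i)\<^sup>2 + \<omega> * \<theta>s i + \<eta>"
      and Q: "(2 - \<beta>) * \<theta>s 0 * a 0 - \<gamma> * (\<theta>s 0 + a 0) + \<rho> - \<omega> \<noteq> 0"
      using askey_wilson[of \<beta> \<gamma> \<rho>] P by blast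
    show "has_spin A As"
      by (rule spin_parameters_imp_spin, rule spin_parameters_of_bilinear_relation[where \<theta> = \<theta>s and a = a])
        (fact d3 inj P N Q nz L)+
  qed (rule spin_imp_bilinear_relation)
  have "2 \<le> d" using d3 by simp
  from spin bilinear_relation_iff_cross_ratio[OF this inj, of a] show ?thesis by (simp only: simp_thms)
qed

end
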